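(* Let $0<a<1/2$. Then for each of the three functions $Y(s,a)$, $O(s,a)$ and $X(s,a)$, the set of its real zeros is exactly the set of negative odd integers $\{-1,-3,-5,\dots\}$, and each of these zeros is simple.
   Context: For $0<a\le 1$ the Hurwitz zeta function is $\zeta(s,a)=\sum_{n=0}^\infty (n+a)^{-s}$ for $\Re(s)>1$, continued meromorphically to $\mathbb{C}$ with a single simple pole at $s=1$ of residue $1$. For $0<a<1$ the periodic zeta function $\mathrm{Li}_s(e^{2\pi i a})=\sum_{n=1}^\infty e^{2\pi i n a}n^{-s}$ ($\Re(s)>1$) extends to an entire function of $s$. For $0<a<1/2$ define $Y(s,a)=\zeta(s,a)-\zeta(s,1-a)$, $O(s,a)=-i\bigl(\mathrm{Li}_s(e^{2\pi i a})-\mathrm{Li}_s(e^{2\pi i(1-a)})\bigr)$ and $X(s,a)=Y(s,a)+O(s,a)$; these are entire functions of $s$. *)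

theory Defs
  imports "HOL-Complex_Analysis.Complex_Analysis"
begin

(* Meant for 0 < a <= 1. The value at the pole s = 1 is set to 0; with that convention the
   continuation is unique (hurwitz_zeta_continuation_unique). *)
definition hurwitz_zeta :: "real \<Rightarrow> complex \<Rightarrow> complex" where
  "hurwitz_zeta a = (THE f. f holomorphic_on - {1} \<and> f 1 = 0 \<and>
     (\<forall>s. Re s > 1 \<longrightarrow> f s = (\<Sum>n. (of_nat n + of_real a) powr (- s))))"

(* s |-> Li_s(exp(2 pi i a)), meant for 0 < a < 1. *)
definition periodic_zeta :: "real \<Rightarrow> complex \<Rightarrow> complex" where
  "periodic_zeta a = (THE f. f holomorphic_on UNIV \<and>
     (\<forall>s. Re s > 1 \<longrightarrow>
        f s = (\<Sum>n. exp (2 * of_real pi * \<i> * of_nat (Suc n) * of_real a)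
                     * of_nat (Suc n) powr (- s))))"

(* The poles at s = 1 cancel; remove_sings supplies the value of the entire function there. *)
definition Y_zeta :: "real \<Rightarrow> complex \<Rightarrow> complex" where
  "Y_zeta a = remove_sings (\<lambda>s. hurwitz_zeta a s - hurwitz_zeta (1 - a) s)"

definition O_zeta :: "real \<Rightarrow> complex \<Rightarrow> complex" where
  "O_zeta a s = - \<i> * (periodic_zeta a s - periodic_zeta (1 - a) s)"

definition X_zeta :: "real \<Rightarrow> complex \<Rightarrow> complex" where
  "X_zeta a s = Y_zeta a s + O_zeta a s"

lemma hurwitz_zeta_continuation_unique:
  fixes f g :: "complex \<Rightarrow> complex"
  assumes "f holomorphic_on - {1}" "g holomorphic_on - {1}" "f 1 = g 1"
    and "\<And>s. Re s > 1 \<Longrightarrow> f s = g s"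
  shows "f = g"
proof
  fix s
  show "f s = g s"
  proof (cases "s = 1")
    case False
    show ?thesis
    proof (rule analytic_continuation_open[of "{s. Re s > 1}" "- {1}" f g])
      show "open {s. Re s > 1}" by (rule open_halfspace_Re_gt)
      have "(2::complex) \<in> {s. Re s > 1}" by simp
      then show "{s. Re s > 1} \<noteq> {}" by blast
      show "connected (- {1::complex})"
        by (rule connected_punctured_universe) simp
    qed (use assms False in auto)
  qed (use assms in simp)
qed

lemma periodic_zeta_continuation_unique:
  fixes f g :: "complex \<Rightarrow> complex"
  assumes "f holomorphic_on UNIV" "g holomorphic_on UNIV"
    and "\<And>s. Re s > 1 \<Longrightarrow> f s = g s"
  shows "f = g"
proof
  fix s
  show "f s = g s"
  proof (rule analytic_continuation_open[of "{s. Re s > 1}" UNIV f g])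
    show "open {s. Re s > 1}" by (rule open_halfspace_Re_gt)
    have "(2::complex) \<in> {s. Re s > 1}" by simp
    then show "{s. Re s > 1} \<noteq> {}" by blast
  qed (use assms in auto)
qed

end

theory Submission
  imports Defs
begin

text \<open>
  On the positive real axis $Y$ is a series of positive terms, and $\Gamma(s)\,O(s,a)$ is the Mellin
  transform of the positive function $\sin\theta/(\cosh x - \cos\theta)$ with $\theta = 2\pi a$.
  Expanding this kernel in partial fractions and integrating termwise for $0 < s < 1$ gives
  $O(s) = \chi(s)\,Y(1-s)$ with $\chi(s) = 2(2\pi)^{s-1}\,\Gamma(1-s)\cos(\pi s/2)$. Since
  $\chi(s)\chi(1-s) = 1$, also $Y(s) = \chi(s)\,O(1-s)$, so $X(s) = \chi(s)\,X(1-s)$. For $s \le 0$ the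
  reflected function is positive at $1-s$ and the Gamma factor does not vanish, so the zeros are
  exactly those of the cosine, with the same multiplicity.

  The continuations to all of $\mathbb{C}$ come from recursions that express $L(s,b) = \sum_n z^n (n+b)^{-s}$
  through the values $L(s+1, b+v)$, $0 \le v \le 1$, and thus gain one strip at a time.
\<close>

section \<open>Continuation by strips\<close>

text \<open>Absolute convergence shapes the argument. In the strip 0 < s < 1, where the functional
  equation is first proved, neither the series of z^n n^(-s) nor that of (n+a)^(s-1) converges
  absolutely. So series of differences are used throughout: \<open>Y\<close> pairs a with 1 - a, the
  periodic zeta function pairs n + 1 with n + 2 at the price of a factor 1 - z, and the partial
  fractions of the kernel are paired like \<open>Y\<close>. Each pairing gains a power of n, enough
  to exchange sum and integral. The strip is the common range of two requirements: the kernel is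
  finite and nonzero at x = 0, so its Mellin transform needs s > 0, and the integrated partial
  fractions are dominated by a multiple of n^(s-2), which needs s < 1. The identity theorem then
  carries the equations to Re s < 1, where Gamma(1-s) has no pole; this half-plane contains every
  real point not settled by positivity on s > 0. The bound a < 1/2 supplies the signs: a < 1 - a for
  the terms of \<open>Y\<close>, sin(2 pi a) > 0 for the kernel.\<close>

text \<open>Morera's theorem: over a triangle the two integrations may be exchanged, and for each
  fixed \<open>v\<close> the inner contour integral vanishes by Cauchy's theorem.\<close>

lemma holomorphic_on_integral_unit_interval:
  fixes f :: "complex \<Rightarrow> real \<Rightarrow> complex"
  assumes U: "open U" and cont: "continuous_on (U \<times> {0..1}) (\<lambda>(s,v). f s v)"
    and hol: "\<And>v. v \<in> {0..1} \<Longrightarrow> (\<lambda>s. f s v) holomorphic_on U"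
  shows "(\<lambda>s. integral {0..1} (f s)) holomorphic_on U"
proof -
  \<comment> \<open>Writing the real integral as a contour integral along [0,1] makes the exchange
    an instance of \<open>contour_integral_swap\<close>.\<close>
  define F where "F s = contour_integral (linepath 0 1) (\<lambda>z. f s (Re z))" for s
  have F: "F s = integral {0..1} (f s)" for s
    by (simp add: F_def contour_integral_integral linepath_def scaleR_conv_of_real)
  have "continuous_on U (\<lambda>s. integral (cbox 0 1) (f s))"
    by (rule integral_continuous_on_param) (use cont in simp)
  hence contF: "continuous_on U F" by (simp add: F fun_eq_iff)
  have "F analytic_on U"
  proof (rule Morera_triangle[OF contF U])
    fix a b c :: complex
    show "convex hull {a, b, c} \<subseteq> U \<longrightarrow> contour_integral (linepath a b) F +
        contour_integral (linepath b c) F + contour_integral (linepath c a) F = 0"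
    proof
      assume sub: "convex hull {a, b, c} \<subseteq> U"
      have seg: "closed_segment a b \<subseteq> U" "closed_segment b c \<subseteq> U" "closed_segment c a \<subseteq> U"
        using sub hull_mono[of "{a,b}" "{a,b,c}" convex] hull_mono[of "{b,c}" "{a,b,c}" convex]
          hull_mono[of "{c,a}" "{a,b,c}" convex]
        by (auto simp: segment_convex_hull)
      define K where "K p q v = contour_integral (linepath p q) (\<lambda>s. f s v)" for p q v
      have K_int: "K p q v = (q - p) * integral (cbox 0 1) (\<lambda>x. f (linepath p q x) v)" for p q v
        by (simp add: K_def contour_integral_integral mult.commute)
      have contK: "continuous_on {0..1} (K p q)" if "closed_segment p q \<subseteq> U" for p q
      proof -
        have "continuous_on ({0..1} \<times> cbox 0 1)
            (\<lambda>x. (\<lambda>(s,v). f s v) (linepath p q (snd x), fst x))"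
          by (rule continuous_on_compose2[OF cont])
             (use that linepath_in_path[of _ p q] in \<open>auto intro!: continuous_intros simp: linepath_def\<close>)
        hence "continuous_on {0..1} (\<lambda>v. integral (cbox 0 1) (\<lambda>x. f (linepath p q x) v))"
          by (intro integral_continuous_on_param) (simp add: case_prod_unfold)
        thus ?thesis unfolding K_int by (intro continuous_intros)
      qed
      have swap: "contour_integral (linepath p q) F = integral {0..1} (K p q)"
        if "closed_segment p q \<subseteq> U" for p q
      proof -
        have "contour_integral (linepath p q) F =
            contour_integral (linepath 0 1) (\<lambda>z. contour_integral (linepath p q) (\<lambda>s. f s (Re z)))"
          unfolding F_def
        proof (rule contour_integral_swap)
          have "continuous_on (closed_segment p q \<times> closed_segment 0 1)
              (\<lambda>x. (\<lambda>(s,v). f s v) (fst x, Re (snd x)))"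
            by (rule continuous_on_compose2[OF cont])
               (use that in \<open>auto intro!: continuous_intros simp: in_segment\<close>)
          thus "continuous_on (path_image (linepath p q) \<times> path_image (linepath 0 1))
              (\<lambda>(y1, y2). f y1 (Re y2))" by (simp add: case_prod_unfold)
        qed auto
        also have "\<dots> = contour_integral (linepath 0 1) (\<lambda>z. K p q (Re z))"
          by (simp only: K_def)
        also have "\<dots> = integral {0..1} (K p q)"
          by (simp add: contour_integral_integral linepath_def scaleR_conv_of_real)
        finally show ?thesis .
      qed
      have zero: "K a b v + K b c v + K c a v = 0" if "v \<in> {0..1}" for v
      proof -
        have h: "(\<lambda>s. f s v) holomorphic_on convex hull {a,b,c}"
          using hol[OF that] sub holomorphic_on_subset by blast
        hence "((\<lambda>s. f s v) has_contour_integral 0)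
            (linepath a b +++ linepath b c +++ linepath c a)"
          by (rule Cauchy_theorem_triangle)
        from has_chain_integral_chain_integral3[OF this] show ?thesis by (simp add: K_def)
      qed
      have "integral {0..1} (K a b) + integral {0..1} (K b c) + integral {0..1} (K c a) =
          integral {0..1} (\<lambda>v. K a b v + K b c v + K c a v)"
        using contK seg by (subst integral_add; (subst integral_add)?)
          (auto intro!: integrable_continuous_interval continuous_intros)
      also have "\<dots> = integral {0..1} (\<lambda>v::real. 0)" by (rule integral_cong) (rule zero)
      finally show "contour_integral (linepath a b) F + contour_integral (linepath b c) F +
          contour_integral (linepath c a) F = 0"
        using swap seg by simp
    qed
  qed
  moreover have "F = (\<lambda>s. integral {0..1} (f s))" by (simp add: F fun_eq_iff)
  ultimately show ?thesis using analytic_imp_holomorphic by metis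
qed

text \<open>
  Joint continuity is what makes the integral over the second argument continuous and (by Morera)
  holomorphic again, so that the recursion can be iterated.
\<close>

definition par_holomorphic :: "real \<Rightarrow> (complex \<Rightarrow> real \<Rightarrow> complex) \<Rightarrow> bool" where
  "par_holomorphic \<sigma> G \<longleftrightarrow> continuous_on ({s. Re s > \<sigma>} \<times> {0<..}) (\<lambda>(s,b). G s b) \<and>
     (\<forall>b>0. (\<lambda>s. G s b) holomorphic_on {s. Re s > \<sigma>})"

text \<open>The integrand samples \<open>G\<close> at \<open>s + 1\<close>, so the half-plane grows
  by one to the left. It also samples at \<open>b + v\<close>, which leaves (0,1]; hence the
  parameter ranges over all positive reals. The data \<open>A\<close>, \<open>e\<close>,
  \<open>p\<close>, \<open>w\<close> stay general to cover both the case z = 1 and the case z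
  \<noteq> 1.\<close>

lemma par_holomorphic_step:
  fixes w :: "real \<Rightarrow> complex"
  assumes G: "par_holomorphic \<sigma> G" and w: "continuous_on {0..1} w"
    and e: "e holomorphic_on UNIV" and p: "p holomorphic_on UNIV" and A: "A holomorphic_on UNIV"
  shows "par_holomorphic (\<sigma> - 1)
    (\<lambda>s b. A s * of_real b powr e s + p s * integral {0..1} (\<lambda>v. w v * G (s + 1) (b + v)))"
proof -
  have contG: "continuous_on ({s. Re s > \<sigma>} \<times> {0<..}) (\<lambda>(s,b). G s b)"
    and holG: "\<And>b. b > 0 \<Longrightarrow> (\<lambda>s. G s b) holomorphic_on {s. Re s > \<sigma>}"
    using G by (auto simp: par_holomorphic_def)
  have op: "open {s. Re s > c}" for c by (rule open_halfspace_Re_gt)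
  have comp: "(\<lambda>s. G (s + 1) b) holomorphic_on {s. Re s > \<sigma> - 1}" if "b > 0" for b
  proof -
    have "((\<lambda>s. G s b) \<circ> (\<lambda>s. s + 1)) holomorphic_on {s. Re s > \<sigma> - 1}"
      by (rule holomorphic_on_compose_gen[OF _ holG[OF that]]) (auto intro!: holomorphic_intros)
    thus ?thesis by (simp add: o_def)
  qed
  have contI: "continuous_on (({s. Re s > \<sigma> - 1} \<times> {0<..}) \<times> {0..1})
      (\<lambda>x. w (snd x) * G (fst (fst x) + 1) (snd (fst x) + snd x))"
  proof (intro continuous_on_mult)
    show "continuous_on (({s. Re s > \<sigma> - 1} \<times> {0<..}) \<times> {0..1}) (\<lambda>x. w (snd x))"
      by (rule continuous_on_compose2[OF w]) (auto intro!: continuous_intros)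
    have "continuous_on (({s. Re s > \<sigma> - 1} \<times> {0<..}) \<times> {0..1})
        (\<lambda>x. (\<lambda>(s,b). G s b) (fst (fst x) + 1, snd (fst x) + snd x))"
      by (rule continuous_on_compose2[OF contG]) (auto intro!: continuous_intros)
    thus "continuous_on (({s. Re s > \<sigma> - 1} \<times> {0<..}) \<times> {0..1})
        (\<lambda>x. G (fst (fst x) + 1) (snd (fst x) + snd x))" by simp
  qed
  define I where "I s b = integral {0..1} (\<lambda>v. w v * G (s + 1) (b + v))" for s b
  have "continuous_on ({s. Re s > \<sigma> - 1} \<times> {0<..})
      (\<lambda>x. integral (cbox 0 1) (\<lambda>v. w v * G (fst x + 1) (snd x + v)))"
    by (rule integral_continuous_on_param) (use contI in \<open>simp add: case_prod_unfold\<close>)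
  hence c1: "continuous_on ({s. Re s > \<sigma> - 1} \<times> {0<..}) (\<lambda>x. I (fst x) (snd x))"
    by (simp add: I_def)
  have h1: "(\<lambda>s. I s b) holomorphic_on {s. Re s > \<sigma> - 1}" if b: "b > 0" for b
    unfolding I_def
  proof (rule holomorphic_on_integral_unit_interval[OF op])
    have "continuous_on ({s. Re s > \<sigma> - 1} \<times> {0..1})
       (\<lambda>y. (\<lambda>x. w (snd x) * G (fst (fst x) + 1) (snd (fst x) + snd x)) ((fst y, b), snd y))"
      by (rule continuous_on_compose2[OF contI]) (use b in \<open>auto intro!: continuous_intros\<close>)
    thus "continuous_on ({s. Re s > \<sigma> - 1} \<times> {0..1}) (\<lambda>(s, v). w v * G (s + 1) (b + v))"
      by (simp add: case_prod_unfold)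
  qed (use b in \<open>auto intro!: holomorphic_intros comp\<close>)
  have ce: "continuous_on X (\<lambda>x. h (fst x))" if "h holomorphic_on UNIV"
    for X :: "(complex \<times> real) set" and h :: "complex \<Rightarrow> complex"
    by (rule continuous_on_compose2[OF holomorphic_on_imp_continuous_on[OF that]])
       (auto intro!: continuous_intros)
  show ?thesis
    unfolding par_holomorphic_def I_def[symmetric] case_prod_unfold
  proof (intro conjI allI impI)
    show "continuous_on ({s. \<sigma> - 1 < Re s} \<times> {0<..})
        (\<lambda>x. A (fst x) * of_real (snd x) powr e (fst x) + p (fst x) * I (fst x) (snd x))"
      by (intro continuous_on_add continuous_on_mult ce A p c1 continuous_on_powr_complex e)
         (auto intro!: continuous_intros)
    show "(\<lambda>s. A s * of_real b powr e s + p s * I s b) holomorphic_on {s. \<sigma> - 1 < Re s}"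
      if "b > 0" for b
      by (intro holomorphic_intros h1 holomorphic_on_subset[OF A] holomorphic_on_subset[OF p]
          holomorphic_on_subset[OF e]) (use that in auto)
  qed
qed

lemma entire_extension_of_half_planes:
  assumes "\<And>n::nat. \<exists>f. f holomorphic_on {s. Re s > c - real n} \<and> (\<forall>s. Re s > c \<longrightarrow> f s = g s)"
  shows "\<exists>f. f holomorphic_on UNIV \<and> (\<forall>s. Re s > c \<longrightarrow> f s = g s)"
proof -
  from assms obtain F where holF: "\<And>n::nat. F n holomorphic_on {s. Re s > c - real n}"
    and F: "\<And>n s. Re s > c \<Longrightarrow> F n s = g s" by metis
  \<comment> \<open>The index is one whose half-plane contains \<open>s\<close>; the
    \<open>+ 1\<close> makes the inequality strict. The choice does not matter, since any two of the
    \<open>F n\<close> agree where both are defined.\<close>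
  define f where "f s = F (nat \<lceil>c - Re s\<rceil> + 1) s" for s
  have eq: "F m s = F n s" if mn: "m \<le> n" and s: "Re s > c - real m" for m n s
  proof (rule analytic_continuation_open[of "{s. Re s > c}" "{s. Re s > c - real m}" "F m" "F n"])
    have "of_real (c + 1) \<in> {s. Re s > c}" by simp
    thus "{s. Re s > c} \<noteq> {}" by blast
    show "F n holomorphic_on {s. Re s > c - real m}"
      by (rule holomorphic_on_subset[OF holF]) (use mn in auto)
    show "connected {s. Re s > c - real m}"
      by (intro convex_connected convex_halfspace_Re_gt)
  qed (use s F holF in \<open>auto simp: open_halfspace_Re_gt\<close>)
  have fF: "f s = F n s" if "Re s > c - real n" for s n
  proof -
    have "Re s > c - (nat \<lceil>c - Re s\<rceil> + 1)" by linarith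
    hence "F (nat \<lceil>c - Re s\<rceil> + 1) s = F (max n (nat \<lceil>c - Re s\<rceil> + 1)) s"
      by (intro eq) auto
    also have "\<dots> = F n s" by (rule eq[symmetric]) (use that in auto)
    finally show ?thesis by (simp add: f_def)
  qed
  have "f holomorphic_on (\<Union>n. {s. Re s > c - real n})"
  proof (intro holomorphic_on_UN_open)
    fix n :: nat
    show "f holomorphic_on {s. Re s > c - real n}"
      using holF[of n] fF holomorphic_cong[of "{s. Re s > c - real n}" _ f "F n"] by auto
  qed (auto simp: open_halfspace_Re_gt)
  also have "(\<Union>n. {s. Re s > c - real n}) = UNIV"
  proof -
    have "\<exists>n. Re s > c - real n" for s
      using reals_Archimedean2[of "c - Re s"] by (auto simp: algebra_simps)
    thus ?thesis by blast
  qed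
  finally have "f holomorphic_on UNIV" .
  moreover have "f s = g s" if "Re s > c" for s
    using fF[of 0 s] F that by simp
  ultimately show ?thesis by blast
qed

text \<open>For Re s > 1 the recursion is an identity; further left it becomes the definition of the
  next extension. The induction treats all b > 0 at once because the value at \<open>b\<close>
  depends on the whole interval [b, b+1].\<close>

lemma entire_extension_of_recursion:
  fixes w :: "real \<Rightarrow> complex"
  assumes G: "par_holomorphic 1 G" and w: "continuous_on {0..1} w"
    and e: "e holomorphic_on UNIV" and p: "p holomorphic_on UNIV" and A: "A holomorphic_on UNIV"
    and rec: "\<And>s b. Re s > 1 \<Longrightarrow> b > 0 \<Longrightarrow> G s b =
      A s * of_real b powr e s + p s * integral {0..1} (\<lambda>v. w v * G (s + 1) (b + v))"
    and b: "b > 0"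
  shows "\<exists>f. f holomorphic_on UNIV \<and> (\<forall>s. Re s > 1 \<longrightarrow> f s = G s b)"
proof (rule entire_extension_of_half_planes)
  fix n :: nat
  have "\<exists>H. par_holomorphic (1 - real n) H \<and> (\<forall>s b. Re s > 1 \<longrightarrow> b > 0 \<longrightarrow> H s b = G s b)"
  proof (induction n)
    case 0
    show ?case using G by auto
  next
    case (Suc n)
    then obtain H where H: "par_holomorphic (1 - real n) H"
      and HG: "\<And>s b. Re s > 1 \<Longrightarrow> b > 0 \<Longrightarrow> H s b = G s b" by blast
    let ?H = "\<lambda>s b. A s * of_real b powr e s +
      p s * integral {0..1} (\<lambda>v. w v * H (s + 1) (b + v))"
    have "par_holomorphic (1 - real (Suc n)) ?H"
      using par_holomorphic_step[OF H w e p A] by (simp add: algebra_simps)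
    moreover have "?H s b = G s b" if "Re s > 1" "b > 0" for s b
    proof -
      have "integral {0..1} (\<lambda>v. w v * H (s + 1) (b + v)) =
          integral {0..1} (\<lambda>v. w v * G (s + 1) (b + v))"
        by (rule integral_cong) (use that in \<open>auto simp: HG\<close>)
      thus ?thesis using rec that by simp
    qed
    ultimately show ?case by blast
  qed
  thus "\<exists>f. f holomorphic_on {s. Re s > 1 - real n} \<and> (\<forall>s. Re s > 1 \<longrightarrow> f s = G s b)"
    using b unfolding par_holomorphic_def by blast
qed

section \<open>The Lerch series\<close>

text \<open>The Lerch transcendent. At z = 1 it is the Hurwitz zeta series; for |z| = 1 the series
  of Li_s(z) is \<open>z * lerch z s 1\<close>, because it starts at n = 1.\<close>

definition lerch :: "complex \<Rightarrow> complex \<Rightarrow> real \<Rightarrow> complex" where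
  "lerch z s b = (\<Sum>n. z ^ n * of_real (real n + b) powr (- s))"

lemma norm_of_real_powr: "x > 0 \<Longrightarrow> norm (of_real x powr (s :: complex)) = x powr Re s"
  by (subst norm_powr_real_powr) auto

lemma continuous_on_of_real_powr:
  fixes h :: "'a :: topological_space \<Rightarrow> complex"
  assumes "continuous_on A g" "continuous_on A h" "\<And>x. x \<in> A \<Longrightarrow> g x > (0 :: real)"
  shows "continuous_on A (\<lambda>x. of_real (g x) powr h x)"
  by (intro continuous_on_powr_complex continuous_on_of_real assms(1,2))
     (auto dest!: assms(3))

text \<open>Dropping \<open>b\<close> makes the bound uniform in the parameter. The index 0 is
  excluded because \<open>0 powr (- \<sigma>)\<close> is 0, so the bound would fail there; this is
  why the M-tests below are used in their eventual form.\<close>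

lemma norm_lerch_term_le:
  assumes "norm z \<le> 1" "b > 0" "\<sigma> \<le> Re s" "\<sigma> \<ge> 0" "n > 0"
  shows "norm (z ^ n * of_real (real n + b) powr (- s)) \<le> real n powr (- \<sigma>)"
proof -
  have "norm (z ^ n * of_real (real n + b) powr (- s)) \<le> 1 * (real n + b) powr (- Re s)"
    unfolding norm_mult using assms
    by (intro mult_mono) (auto simp: norm_power power_le_one norm_of_real_powr simp del: of_real_add)
  also have "\<dots> \<le> (real n + b) powr (- \<sigma>)"
    using assms by (simp add: powr_mono)
  also have "\<dots> \<le> real n powr (- \<sigma>)"
    using assms by (intro powr_mono2') auto
  finally show ?thesis .
qed

text \<open>With \<open>S\<close> and \<open>B\<close> as functions on an arbitrary set, one
  statement gives both the joint continuity in (s,b) and, for fixed \<open>b\<close>, the local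
  uniform convergence in \<open>s\<close>.\<close>

lemma lerch_uniform_limit:
  assumes "norm z \<le> 1" "\<sigma> > 1" "\<And>x. x \<in> A \<Longrightarrow> \<sigma> \<le> Re (S x)" "\<And>x. x \<in> A \<Longrightarrow> B x > 0"
  shows "uniform_limit A (\<lambda>N x. \<Sum>n<N. z ^ n * of_real (real n + B x) powr (- S x))
           (\<lambda>x. lerch z (S x) (B x)) sequentially"
  unfolding lerch_def
proof (rule Weierstrass_m_test_ev)
  show "\<forall>\<^sub>F n in sequentially. \<forall>x\<in>A.
      norm (z ^ n * of_real (real n + B x) powr (- S x)) \<le> real n powr (- \<sigma>)"
    using eventually_gt_at_top[of 0] by eventually_elim (use assms norm_lerch_term_le in auto)
  show "summable (\<lambda>n. real n powr (- \<sigma>))"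
    using assms by (simp add: summable_real_powr_iff)
qed

lemma summable_norm_lerch:
  assumes "norm z \<le> 1" "Re s > 1" "b > 0"
  shows "summable (\<lambda>n. norm (z ^ n * of_real (real n + b) powr (- s)))"
proof (rule summable_comparison_test_ev)
  show "\<forall>\<^sub>F n in sequentially.
      norm (norm (z ^ n * of_real (real n + b) powr (- s))) \<le> real n powr (- Re s)"
    using eventually_gt_at_top[of 0] by eventually_elim (use assms norm_lerch_term_le in auto)
  show "summable (\<lambda>n. real n powr (- Re s))"
    using assms by (simp add: summable_real_powr_iff)
qed

lemma lerch_sums:
  assumes "norm z \<le> 1" "Re s > 1" "b > 0"
  shows "(\<lambda>n. z ^ n * of_real (real n + b) powr (- s)) sums lerch z s b"
  unfolding lerch_def using summable_norm_cancel[OF summable_norm_lerch[OF assms]]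
  by (rule summable_sums)

lemma par_holomorphic_lerch:
  assumes z: "norm z \<le> 1"
  shows "par_holomorphic 1 (lerch z)"
  unfolding par_holomorphic_def
proof (intro conjI allI impI)
  have op: "open ({s. Re s > c} \<times> {0::real<..})" for c
    by (intro open_Times open_halfspace_Re_gt open_greaterThan)
  have "continuous_on ({s. Re s > \<sigma>} \<times> {0<..}) (\<lambda>x. lerch z (fst x) (snd x))" if "\<sigma> > 1" for \<sigma>
  proof (rule uniform_limit_theorem[OF _ lerch_uniform_limit[OF z that]])
    show "\<forall>\<^sub>F N in sequentially. continuous_on ({s. Re s > \<sigma>} \<times> {0<..})
       (\<lambda>x. \<Sum>n<N. z ^ n * of_real (real n + snd x) powr (- fst x))"
      by (intro always_eventually allI continuous_on_sum continuous_on_mult continuous_on_const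
          continuous_on_of_real_powr) (auto intro!: continuous_intros)
  qed auto
  hence "isCont (\<lambda>x. lerch z (fst x) (snd x)) x" if "Re (fst x) > \<sigma>" "snd x > 0" "\<sigma> > 1" for x \<sigma>
    using that continuous_on_eq_continuous_at[OF op, of \<sigma>] by (cases x) auto
  hence "isCont (\<lambda>x. lerch z (fst x) (snd x)) x" if "Re (fst x) > 1" "snd x > 0" for x
    using that dense by blast
  thus "continuous_on ({s. Re s > 1} \<times> {0<..}) (\<lambda>(s, b). lerch z s b)"
    by (auto simp: continuous_on_eq_continuous_at[OF op] case_prod_unfold)
next
  fix b :: real assume b: "b > 0"
  show "(\<lambda>s. lerch z s b) holomorphic_on {s. Re s > 1}"
  proof (rule holomorphic_uniform_sequence[OF open_halfspace_Re_gt])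
    show "(\<lambda>s. \<Sum>n<N. z ^ n * of_real (real n + b) powr (- s)) holomorphic_on {s. Re s > 1}" for N
      by (intro holomorphic_intros)
    fix s assume s: "s \<in> {s. Re s > 1}"
    define d where "d = (Re s - 1) / 2"
    have d: "d > 0" "1 < Re s - d" using s by (auto simp: d_def field_simps)
    have Re: "Re s - d \<le> Re t" if "t \<in> cball s d" for t
      using that abs_Re_le_cmod[of "s - t"] by (auto simp: dist_norm)
    have "uniform_limit (cball s d) (\<lambda>N s. \<Sum>n<N. z ^ n * of_real (real n + b) powr (- s))
         (\<lambda>s. lerch z s b) sequentially"
      using lerch_uniform_limit[OF z d(2), of "cball s d" "\<lambda>s. s" "\<lambda>_. b"] Re b by auto
    moreover have "cball s d \<subseteq> {s. Re s > 1}" using Re d by fastforce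
    ultimately show "\<exists>d>0. cball s d \<subseteq> {s. Re s > 1} \<and>
        uniform_limit (cball s d) (\<lambda>N s. \<Sum>n<N. z ^ n * of_real (real n + b) powr (- s))
         (\<lambda>s. lerch z s b) sequentially" using d by blast
  qed
qed

text \<open>The weight is bounded on [0,1], so the series converges uniformly in \<open>v\<close>
  and may be integrated term by term.\<close>

lemma lerch_integral_sums:
  fixes w :: "real \<Rightarrow> complex"
  assumes z: "norm z \<le> 1" and s: "Re s > 1" and b: "b > 0" and w: "continuous_on {0..1} w"
  shows "(\<lambda>n. z ^ n * integral {0..1} (\<lambda>v. w v * of_real (real n + b + v) powr (- s))) sums
           integral {0..1} (\<lambda>v. w v * lerch z s (b + v))"
proof -
  have "compact (w ` {0..1})" by (intro compact_continuous_image w) auto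
  then obtain C where C: "\<And>v. v \<in> {0..1} \<Longrightarrow> norm (w v) \<le> C"
    using compact_imp_bounded bounded_iff by (metis imageI)
  have u: "uniform_limit {0..1}
     (\<lambda>N v. \<Sum>n<N. w v * (z ^ n * of_real (real n + (b + v)) powr (- s)))
     (\<lambda>v. \<Sum>n. w v * (z ^ n * of_real (real n + (b + v)) powr (- s))) sequentially"
  proof (rule Weierstrass_m_test_ev)
    show "\<forall>\<^sub>F n in sequentially. \<forall>v\<in>{0..1}.
        norm (w v * (z ^ n * of_real (real n + (b + v)) powr (- s))) \<le> C * real n powr (- Re s)"
      using eventually_gt_at_top[of 0]
    proof eventually_elim
      case (elim n)
      show ?case
      proof
        fix v :: real assume v: "v \<in> {0..1}"
        have "norm (w v) * norm (z ^ n * of_real (real n + (b + v)) powr (- s))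
            \<le> C * real n powr (- Re s)"
          by (rule mult_mono'[OF C norm_lerch_term_le]) (use elim z s b v in auto)
        thus "norm (w v * (z ^ n * of_real (real n + (b + v)) powr (- s))) \<le> C * real n powr (- Re s)"
          by (simp only: norm_mult)
      qed
    qed
    show "summable (\<lambda>n. C * real n powr (- Re s))"
      using s by (intro summable_mult) (simp add: summable_real_powr_iff)
  qed
  have cont: "continuous_on {0..1} (\<lambda>v. of_real (real n + (b + v)) powr (- s))" for n
    by (intro continuous_on_of_real_powr) (use b in \<open>auto intro!: continuous_intros\<close>)
  obtain I J where I: "\<And>N. ((\<lambda>v. \<Sum>n<N. w v * (z ^ n * of_real (real n + (b + v)) powr (- s)))
        has_integral I N) {0..1}"
    and J: "((\<lambda>v. \<Sum>n. w v * (z ^ n * of_real (real n + (b + v)) powr (- s))) has_integral J) {0..1}"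
    and lim: "I \<longlonglongrightarrow> J"
    by (rule uniform_limit_integral[OF u])
       (auto intro!: continuous_on_sum continuous_on_mult continuous_on_const w cont simp del: of_real_add)
  have "I = (\<lambda>N. \<Sum>n<N. z ^ n * integral {0..1} (\<lambda>v. w v * of_real (real n + b + v) powr (- s)))"
  proof
    fix N
    have "I N = integral {0..1} (\<lambda>v. \<Sum>n<N. z ^ n * (w v * of_real (real n + (b + v)) powr (- s)))"
      using I[of N] by (simp add: integral_unique mult.left_commute)
    also have "\<dots> = (\<Sum>n<N. integral {0..1} (\<lambda>v. z ^ n * (w v * of_real (real n + (b + v)) powr (- s))))"
      by (intro integral_sum integrable_continuous_interval continuous_on_mult
          continuous_on_const w cont) auto
    finally show "I N = (\<Sum>n<N. z ^ n * integral {0..1} (\<lambda>v. w v * of_real (real n + b + v) powr (- s)))"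
      by (simp add: add.assoc)
  qed
  with lim have "(\<lambda>n. z ^ n * integral {0..1} (\<lambda>v. w v * of_real (real n + b + v) powr (- s))) sums J"
    by (simp add: sums_def)
  moreover have "integral {0..1} (\<lambda>v. w v * lerch z s (b + v)) = J"
  proof -
    have "integral {0..1} (\<lambda>v. w v * lerch z s (b + v)) =
        integral {0..1} (\<lambda>v. \<Sum>n. w v * (z ^ n * of_real (real n + (b + v)) powr (- s)))"
    proof (rule integral_cong)
      fix v :: real assume "v \<in> {0..1}"
      hence "(\<lambda>n. z ^ n * of_real (real n + (b + v)) powr (- s)) sums lerch z s (b + v)"
        by (intro lerch_sums) (use z s b in auto)
      thus "w v * lerch z s (b + v) = (\<Sum>n. w v * (z ^ n * of_real (real n + (b + v)) powr (- s)))"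
        by (metis sums_mult sums_unique)
    qed
    thus ?thesis using J by (simp add: integral_unique)
  qed
  ultimately show ?thesis by simp
qed

section \<open>Integral recursions for the Lerch series\<close>

lemma has_integral_powr_shift:
  fixes s :: complex
  assumes c: "c > 0"
  shows "((\<lambda>v. s * of_real (c + v) powr (- (s + 1))) has_integral
           (of_real c powr (- s) - of_real (c + 1) powr (- s))) {0..1}"
proof -
  define F where "F w = - ((of_real c + w) powr (- s))" for w :: complex
  have "((\<lambda>v. s * of_real (c + v) powr (- (s + 1))) has_integral
      F (of_real 1) - F (of_real 0)) {0..1}"
  proof (rule fundamental_theorem_of_calculus)
    fix v :: real assume v: "v \<in> {0..1}"
    have "(F has_field_derivative s * of_real (c + v) powr (- (s + 1))) (at (of_real v))"
      unfolding F_def using c v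
      by (auto intro!: derivative_eq_intros simp: complex_nonpos_Reals_iff)
    thus "((\<lambda>v. F (of_real v)) has_vector_derivative s * of_real (c + v) powr (- (s + 1)))
        (at v within {0..1})"
      by (rule has_vector_derivative_real_field)
  qed auto
  thus ?thesis by (simp add: F_def)
qed

text \<open>Integration by parts: the weight 1 - v vanishes at v = 1, so the boundary contributes
  only c^(-s), and what remains is minus the integral of (c+v)^(-s). For c = n + b the latter
  telescopes in n.\<close>

lemma has_integral_linear_powr_shift:
  fixes s :: complex
  assumes c: "c > 0" and s: "s \<noteq> 1"
  shows "((\<lambda>v. s * (of_real (1 - v) * of_real (c + v) powr (- (s + 1)))) has_integral
           (of_real c powr (- s) + (of_real c powr (1 - s) - of_real (c + 1) powr (1 - s)) / (1 - s))) {0..1}"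
proof -
  define F where "F w = - (1 - w) * ((of_real c + w) powr (- s)) - (of_real c + w) powr (1 - s) / (1 - s)"
    for w :: complex
  have "((\<lambda>v. s * (of_real (1 - v) * of_real (c + v) powr (- (s + 1)))) has_integral
      F (of_real 1) - F (of_real 0)) {0..1}"
  proof (rule fundamental_theorem_of_calculus)
    fix v :: real assume v: "v \<in> {0..1}"
    have pos: "of_real c + of_real v \<notin> (\<real>\<^sub>\<le>\<^sub>0 :: complex set)"
      using c v by (simp add: complex_nonpos_Reals_iff)
    have d: "((\<lambda>w. (of_real c + w) powr r) has_field_derivative r * of_real (c + v) powr (r - 1))
        (at (of_real v))" for r :: complex
      using pos by (auto intro!: derivative_eq_intros)
    have "(F has_field_derivative of_real (c + v) powr (- s) +
          (- (1 - of_real v)) * (- s * of_real (c + v) powr (- s - 1)) -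
          ((1 - s) * of_real (c + v) powr (1 - s - 1)) / (1 - s)) (at (of_real v))"
      unfolding F_def
      by (rule DERIV_cong[OF DERIV_diff[OF DERIV_mult[OF _ d] DERIV_cdivide[OF d]], of _ 1])
         (auto intro!: derivative_eq_intros)
    also have "of_real (c + v) powr (- s) +
          (- (1 - of_real v)) * (- s * of_real (c + v) powr (- s - 1)) -
          ((1 - s) * of_real (c + v) powr (1 - s - 1)) / (1 - s) =
        s * (of_real (1 - v) * of_real (c + v) powr (- (s + 1)))"
      using s by (simp, simp add: algebra_simps)
    finally have "(F has_field_derivative s * (of_real (1 - v) * of_real (c + v) powr (- (s + 1))))
        (at (of_real v))" .
    thus "((\<lambda>v. F (of_real v)) has_vector_derivative s * (of_real (1 - v) * of_real (c + v) powr (- (s + 1))))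
        (at v within {0..1})"
      by (rule has_vector_derivative_real_field)
  qed auto
  moreover have "F (of_real 1) - F (of_real 0) =
      of_real c powr (- s) + (of_real c powr (1 - s) - of_real (c + 1) powr (1 - s)) / (1 - s)"
    by (simp add: F_def diff_divide_distrib)
  ultimately show ?thesis by (simp only:)
qed

text \<open>Summing the integrals over c = n + b with weights z^n compares the series with its own
  shift. At z = 1 the left-hand side vanishes and nothing is learned about
  \<open>lerch 1 s b\<close>, so the Hurwitz case needs a different recursion.\<close>

lemma lerch_recursion:
  assumes z: "norm z \<le> 1" and s: "Re s > 1" and b: "b > 0"
  shows "(1 - z) * lerch z s b =
     of_real b powr (- s) - s * z * integral {0..1} (\<lambda>v. lerch z (s + 1) (b + v))"
proof -
  define t where "t n = z ^ n * of_real (real n + b) powr (- s)" for n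
  have "(\<lambda>n. z ^ n * integral {0..1} (\<lambda>v. s * of_real (real n + b + v) powr (- (s + 1)))) sums
      integral {0..1} (\<lambda>v. s * lerch z (s + 1) (b + v))"
    by (rule lerch_integral_sums) (use z s b in auto)
  moreover have "z ^ n * integral {0..1} (\<lambda>v. s * of_real (real n + b + v) powr (- (s + 1))) =
      t n - z ^ n * of_real (real n + b + 1) powr (- s)" for n
    using integral_unique[OF has_integral_powr_shift[of "real n + b" s]] b
    by (simp only: t_def right_diff_distrib)
  ultimately have "(\<lambda>n. t n - z ^ n * of_real (real n + b + 1) powr (- s)) sums
      (s * integral {0..1} (\<lambda>v. lerch z (s + 1) (b + v)))"
    by simp
  hence "(\<lambda>n. z * (t n - z ^ n * of_real (real n + b + 1) powr (- s))) sums
      (z * (s * integral {0..1} (\<lambda>v. lerch z (s + 1) (b + v))))" by (rule sums_mult)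
  \<comment> \<open>The factor \<open>z\<close> turns the shifted summand into exactly the next term
    of the series, without dividing by \<open>z\<close>.\<close>
  moreover have "z * (t n - z ^ n * of_real (real n + b + 1) powr (- s)) = z * t n - t (Suc n)" for n
    by (simp add: t_def algebra_simps)
  moreover have t: "t sums lerch z s b" unfolding t_def by (rule lerch_sums[OF z s b])
  have "(\<lambda>n. t (Suc n)) sums (lerch z s b - t 0)"
    using t sums_Suc_iff[of t "lerch z s b - t 0"] by simp
  with t have "(\<lambda>n. z * t n - t (Suc n)) sums (z * lerch z s b - (lerch z s b - t 0))"
    by (intro sums_diff sums_mult)
  ultimately have "z * (s * integral {0..1} (\<lambda>v. lerch z (s + 1) (b + v))) =
      z * lerch z s b - (lerch z s b - t 0)"
    using sums_unique2 by simp
  thus ?thesis by (simp add: t_def algebra_simps)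
qed

text \<open>
  Subtracting $\int_0^1 \zeta(s,b+v)\,dv = b^{1-s}/(s-1)$ from $\zeta(s,b)$ isolates the pole; one integration
  by parts turns the difference into the weighted integral below.
\<close>

lemma lerch_1_recursion:
  assumes s: "Re s > 1" and b: "b > 0"
  shows "(s - 1) * lerch 1 s b = of_real b powr (1 - s) +
     (s - 1) * integral {0..1} (\<lambda>v. of_real (1 - v) * (s * lerch 1 (s + 1) (b + v)))"
proof -
  define q where "q n = of_real (real n + b) powr (1 - s)" for n
  have s1: "s \<noteq> 1" using s by auto
  have "(\<lambda>n. 1 ^ n * integral {0..1} (\<lambda>v. (s * of_real (1 - v)) * of_real (real n + b + v) powr (- (s + 1)))) sums
      integral {0..1} (\<lambda>v. (s * of_real (1 - v)) * lerch 1 (s + 1) (b + v))"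
    by (rule lerch_integral_sums) (use s b in \<open>auto intro!: continuous_intros\<close>)
  moreover have "integral {0..1} (\<lambda>v. (s * of_real (1 - v)) * of_real (real n + b + v) powr (- (s + 1))) =
      of_real (real n + b) powr (- s) + (q n - q (Suc n)) / (1 - s)" for n
    using has_integral_linear_powr_shift[of "real n + b" s] b s1
    by (simp add: integral_unique q_def algebra_simps)
  ultimately have "(\<lambda>n. of_real (real n + b) powr (- s) + (q n - q (Suc n)) / (1 - s)) sums
      integral {0..1} (\<lambda>v. (s * of_real (1 - v)) * lerch 1 (s + 1) (b + v))"
    by simp
  moreover have "(\<lambda>n. of_real (real n + b) powr (- s) + (q n - q (Suc n)) / (1 - s)) sums
      (lerch 1 s b + (q 0 - 0) / (1 - s))"
  proof (intro sums_add sums_divide telescope_sums')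
    show "(\<lambda>n. of_real (real n + b) powr (- s)) sums lerch 1 s b"
      using lerch_sums[of 1 s b] s b by simp
    have "((\<lambda>n. (real n + b) powr Re (1 - s)) \<longlongrightarrow> 0) sequentially"
      using s by (intro tendsto_neg_powr) (auto intro!: filterlim_tendsto_add_at_top[OF tendsto_const]
        filterlim_real_sequentially simp: add.commute[of _ b])
    hence "(\<lambda>n. norm (q n)) \<longlonglongrightarrow> 0"
      using b by (simp add: q_def norm_of_real_powr add_nonneg_pos del: of_real_add)
    thus "q \<longlonglongrightarrow> 0" by (rule tendsto_norm_zero_cancel)
  qed
  ultimately have "integral {0..1} (\<lambda>v. (s * of_real (1 - v)) * lerch 1 (s + 1) (b + v)) =
      lerch 1 s b + q 0 / (1 - s)"
    using sums_unique2 by fastforce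
  hence "integral {0..1} (\<lambda>v. of_real (1 - v) * (s * lerch 1 (s + 1) (b + v))) =
      lerch 1 s b + q 0 / (1 - s)" by (simp add: mult_ac)
  thus ?thesis using s1 by (simp add: q_def field_simps)
qed

section \<open>The Hurwitz and periodic zeta functions\<close>

text \<open>The recursion is run for (s-1) zeta(s,b), which is entire; its factor at
  \<open>s + 1\<close> is \<open>s\<close>, the factor inside the weighted integral. The point s = 1
  is excluded from the second claim because \<open>hurwitz_zeta a 1\<close> is 0 by convention,
  whereas \<open>Z 1\<close> is the residue.\<close>

lemma hurwitz_zeta_continuation:
  assumes a: "a > 0"
  obtains Z where "Z holomorphic_on UNIV"
    and "\<And>s. s \<noteq> 1 \<Longrightarrow> (s - 1) * hurwitz_zeta a s = Z s"
    and "\<And>s. Re s > 1 \<Longrightarrow> hurwitz_zeta a s = lerch 1 s a"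
proof -
  have "\<exists>f. f holomorphic_on UNIV \<and> (\<forall>s. Re s > 1 \<longrightarrow> f s = (s - 1) * lerch 1 s a)"
  proof (rule entire_extension_of_recursion
      [where w = "\<lambda>v. of_real (1 - v)" and e = "\<lambda>s. 1 - s" and p = "\<lambda>s. s - 1" and A = "\<lambda>_. 1"])
    have "par_holomorphic 1 (lerch 1)" by (rule par_holomorphic_lerch) simp
    thus "par_holomorphic 1 (\<lambda>s b. (s - 1) * lerch 1 s b)"
      unfolding par_holomorphic_def case_prod_unfold
      by (auto intro!: continuous_intros holomorphic_intros)
    show "(s - 1) * lerch 1 s b = 1 * of_real b powr (1 - s) +
        (s - 1) * integral {0..1} (\<lambda>v. of_real (1 - v) * ((s + 1 - 1) * lerch 1 (s + 1) (b + v)))"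
      if "1 < Re s" "0 < b" for s b
      using lerch_1_recursion[OF that] by simp
  qed (use a in \<open>auto intro!: continuous_intros holomorphic_intros\<close>)
  then obtain Z where Z: "Z holomorphic_on UNIV" "\<And>s. Re s > 1 \<Longrightarrow> Z s = (s - 1) * lerch 1 s a"
    by blast
  define f where "f s = (if s = 1 then 0 else Z s / (s - 1))" for s
  have f_hol: "f holomorphic_on - {1}"
  proof (rule holomorphic_transform[of "\<lambda>s. Z s / (s - 1)"])
    show "(\<lambda>s. Z s / (s - 1)) holomorphic_on - {1}"
      by (intro holomorphic_intros holomorphic_on_subset[OF Z(1)]) auto
  qed (auto simp: f_def)
  have f_eq: "f s = lerch 1 s a" if "Re s > 1" for s
    using Z(2)[OF that] that by (auto simp: f_def)
  have "hurwitz_zeta a = f"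
    unfolding hurwitz_zeta_def
  proof (rule the_equality)
    show "f holomorphic_on - {1} \<and> f 1 = 0 \<and>
        (\<forall>s. 1 < Re s \<longrightarrow> f s = (\<Sum>n. (of_nat n + of_real a) powr - s))"
      using f_hol f_eq by (simp add: f_def lerch_def)
    show "g = f" if "g holomorphic_on - {1} \<and> g 1 = 0 \<and>
        (\<forall>s. 1 < Re s \<longrightarrow> g s = (\<Sum>n. (of_nat n + of_real a) powr - s))" for g
      using that f_hol f_eq
      by (intro hurwitz_zeta_continuation_unique) (auto simp: f_def lerch_def)
  qed
  thus ?thesis using that[OF Z(1)] f_eq by (simp add: f_def)
qed

lemma exp_eq_cis_power:
  "exp (2 * of_real pi * \<i> * of_nat n * of_real a) = cis (2 * pi * a) ^ n"
  by (simp add: cis_conv_exp exp_of_nat_mult[symmetric] mult_ac)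

lemma cis_2pi_neq_1:
  assumes "0 < a" "a < 1"
  shows "cis (2 * pi * a) \<noteq> 1"
proof
  assume "cis (2 * pi * a) = 1"
  hence "cos (2 * pi * a) = 1" by (metis cis.sel(1) one_complex.sel(1))
  then obtain k :: int where "2 * pi * a = real_of_int k * 2 * pi" using cos_one_2pi_int by blast
  hence "a = k" by simp
  thus False using assms by simp
qed

text \<open>As 0 < a < 1 gives z \<noteq> 1, the recursion can be divided by 1 - z, and all its
  coefficients are entire: no pole arises.\<close>

lemma periodic_zeta_continuation:
  assumes a: "0 < a" "a < 1"
  defines "z \<equiv> cis (2 * pi * a)"
  shows "periodic_zeta a holomorphic_on UNIV"
    and "\<And>s. Re s > 1 \<Longrightarrow> periodic_zeta a s = z * lerch z s 1"
proof -
  have z: "norm z \<le> 1" "z \<noteq> 1" using cis_2pi_neq_1[OF a] by (simp_all add: z_def)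
  have "\<exists>f. f holomorphic_on UNIV \<and> (\<forall>s. Re s > 1 \<longrightarrow> f s = lerch z s 1)"
  proof (rule entire_extension_of_recursion
      [where w = "\<lambda>_. 1" and e = "\<lambda>s. - s" and p = "\<lambda>s. - s * z / (1 - z)" and A = "\<lambda>_. 1 / (1 - z)"])
    show "par_holomorphic 1 (lerch z)" by (rule par_holomorphic_lerch[OF z(1)])
    show "lerch z s b = 1 / (1 - z) * of_real b powr - s +
        - s * z / (1 - z) * integral {0..1} (\<lambda>v. 1 * lerch z (s + 1) (b + v))"
      if "1 < Re s" "0 < b" for s b
      using arg_cong[OF lerch_recursion[OF z(1) that], of "\<lambda>x. x / (1 - z)"] z(2)
      by (simp add: diff_divide_distrib)
  qed (use z in \<open>auto intro!: holomorphic_intros\<close>)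
  then obtain f where f: "f holomorphic_on UNIV" "\<And>s. Re s > 1 \<Longrightarrow> f s = lerch z s 1"
    by blast
  have sum_eq: "(\<Sum>n. exp (2 * of_real pi * \<i> * of_nat (Suc n) * of_real a) * of_nat (Suc n) powr (- s)) =
      z * lerch z s 1" if "Re s > 1" for s
  proof -
    have "(\<lambda>n. z * (z ^ n * of_real (real n + 1) powr (- s))) sums (z * lerch z s 1)"
      by (intro sums_mult lerch_sums) (use z that in auto)
    also have "(\<lambda>n. z * (z ^ n * of_real (real n + 1) powr (- s))) =
        (\<lambda>n. exp (2 * of_real pi * \<i> * of_nat (Suc n) * of_real a) * of_nat (Suc n) powr (- s))"
      by (simp only: exp_eq_cis_power z_def[symmetric]) (simp add: add.commute mult.assoc)
    finally show ?thesis by (rule sums_unique[symmetric])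
  qed
  have eq: "periodic_zeta a = (\<lambda>s. z * f s)"
    unfolding periodic_zeta_def
  proof (rule the_equality)
    show "(\<lambda>s. z * f s) holomorphic_on UNIV \<and> (\<forall>s. 1 < Re s \<longrightarrow> z * f s =
        (\<Sum>n. exp (2 * of_real pi * \<i> * of_nat (Suc n) * of_real a) * of_nat (Suc n) powr (- s)))"
      using f by (auto intro!: holomorphic_intros simp: sum_eq simp del: of_nat_Suc)
    show "g = (\<lambda>s. z * f s)" if "g holomorphic_on UNIV \<and> (\<forall>s. 1 < Re s \<longrightarrow> g s =
        (\<Sum>n. exp (2 * of_real pi * \<i> * of_nat (Suc n) * of_real a) * of_nat (Suc n) powr (- s)))" for g
      using that f by (intro periodic_zeta_continuation_unique)
        (auto intro!: holomorphic_intros simp: sum_eq simp del: of_nat_Suc)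
  qed
  show "periodic_zeta a holomorphic_on UNIV"
    unfolding eq by (intro holomorphic_intros f)
  show "\<And>s. Re s > 1 \<Longrightarrow> periodic_zeta a s = z * lerch z s 1"
    by (simp add: eq f)
qed

section \<open>Difference series on the half-plane Re s > 0\<close>

text \<open>Mean value inequality for w^(-s) on a real segment. The derivative carries the exponent
  - Re s - 1, which is the gain of one power; it is at most 0, so the bound is attained at the left
  end \<open>m\<close>.\<close>

lemma norm_powr_diff_le:
  fixes s :: complex
  assumes m: "m > 0" "m \<le> x" "m \<le> y" and s: "Re s \<ge> - 1"
  shows "norm (of_real x powr (- s) - of_real y powr (- s)) \<le> norm s * m powr (- Re s - 1) * \<bar>x - y\<bar>"
proof -
  have "norm (of_real x powr (- s) - of_real y powr (- s)) \<le>
      norm s * m powr (- Re s - 1) * norm (of_real x - of_real y :: complex)"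
  proof (rule field_differentiable_bound[where S = "of_real ` closed_segment x y"])
    have "convex (closed_segment (of_real x) (of_real y :: complex))" by simp
    thus "convex (of_real ` closed_segment x y :: complex set)"
      by (simp add: closed_segment_of_real)
    fix w :: complex assume "w \<in> of_real ` closed_segment x y"
    then obtain t where t: "t \<ge> m" "w = of_real t"
      using m by (auto simp: closed_segment_eq_real_ivl split: if_splits)
    show "((\<lambda>w. w powr (- s)) has_field_derivative - s * w powr (- s - 1))
        (at w within of_real ` closed_segment x y)"
      using t m by (auto intro!: derivative_eq_intros simp: complex_nonpos_Reals_iff)
    have "t powr (- Re s - 1) \<le> m powr (- Re s - 1)"
      using t m s by (intro powr_mono2') auto
    thus "norm (- s * w powr (- s - 1)) \<le> norm s * m powr (- Re s - 1)"
      using t m by (simp add: norm_mult norm_of_real_powr mult_left_mono)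
  qed auto
  also have "norm (of_real x - of_real y :: complex) = \<bar>x - y\<bar>"
    by (metis norm_of_real of_real_diff)
  finally show ?thesis .
qed

text \<open>Differences of shifted powers are of order n^(- Re s - 1), so absolute convergence
  reaches down to Re s > 0. The coefficients \<open>c n\<close> are 1 for \<open>Y_zeta\<close> and
  z^n for the periodic zeta function.\<close>

lemma dirichlet_difference:
  fixes c :: "nat \<Rightarrow> complex"
  assumes c: "\<And>n. norm (c n) \<le> 1" and b: "b > 0" "b' > 0"
  shows "Re s > 0 \<Longrightarrow> summable (\<lambda>n. norm (c n * (of_real (real n + b) powr (- s) - of_real (real n + b') powr (- s))))"
    and "(\<lambda>s. \<Sum>n. c n * (of_real (real n + b) powr (- s) - of_real (real n + b') powr (- s)))
           holomorphic_on {s. Re s > 0}"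
proof -
  define u where "u n s = c n * (of_real (real n + b) powr (- s) - of_real (real n + b') powr (- s))" for n s
  \<comment> \<open>The derivative contributes a factor |s|, so the estimate is uniform only for
    bounded \<open>s\<close> with Re s bounded away from 0; closed discs suffice for local uniform
    convergence.\<close>
  have u_le: "norm (u n s) \<le> R * \<bar>b - b'\<bar> * real n powr (- \<delta> - 1)"
    if "n > 0" "norm s \<le> R" "Re s \<ge> \<delta>" "\<delta> > 0" for n s R \<delta>
  proof -
    have "R \<ge> 0" using that(2) norm_ge_zero[of s] by linarith
    have "norm (of_real (real n + b) powr (- s) - of_real (real n + b') powr (- s)) \<le>
        norm s * real n powr (- Re s - 1) * \<bar>(real n + b) - (real n + b')\<bar>"
      by (rule norm_powr_diff_le) (use that b in auto)
    also have "\<dots> \<le> R * real n powr (- \<delta> - 1) * \<bar>(real n + b) - (real n + b')\<bar>"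
      by (intro mult_mono powr_mono) (use that \<open>R \<ge> 0\<close> in auto)
    finally have "norm (c n) * norm (of_real (real n + b) powr (- s) - of_real (real n + b') powr (- s))
        \<le> 1 * (R * real n powr (- \<delta> - 1) * \<bar>(real n + b) - (real n + b')\<bar>)"
      by (intro mult_mono c) auto
    thus ?thesis by (simp add: u_def norm_mult mult_ac)
  qed
  have sm: "summable (\<lambda>n. R * \<bar>b - b'\<bar> * real n powr (- \<delta> - 1))" if "\<delta> > 0" for R \<delta>
    using that by (intro summable_mult) (simp add: summable_real_powr_iff)
  show "summable (\<lambda>n. norm (c n * (of_real (real n + b) powr (- s) - of_real (real n + b') powr (- s))))"
    if s: "Re s > 0"
  proof (rule summable_comparison_test_ev[OF _ sm[OF s, of "norm s"]])
    show "\<forall>\<^sub>F n in sequentially. norm (norm (c n * (of_real (real n + b) powr (- s) -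
        of_real (real n + b') powr (- s)))) \<le> norm s * \<bar>b - b'\<bar> * real n powr (- Re s - 1)"
      using eventually_gt_at_top[of 0]
      by eventually_elim (use u_le[of _ s "norm s" "Re s"] s in \<open>simp add: u_def\<close>)
  qed
  have "(\<lambda>s. \<Sum>n. u n s) holomorphic_on {s. Re s > 0}"
  proof (rule holomorphic_uniform_sequence[OF open_halfspace_Re_gt])
    show "(\<lambda>s. \<Sum>n<N. u n s) holomorphic_on {s. Re s > 0}" for N
      unfolding u_def by (intro holomorphic_intros)
    fix s assume s: "s \<in> {s. Re s > 0}"
    define d where "d = Re s / 2"
    have d: "d > 0" "Re s - d = d" using s by (auto simp: d_def field_simps)
    have Re: "d \<le> Re t" "norm t \<le> norm s + d" if "t \<in> cball s d" for t
      using that abs_Re_le_cmod[of "s - t"] d norm_triangle_sub[of t s]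
      by (auto simp: dist_norm norm_minus_commute)
    have "uniform_limit (cball s d) (\<lambda>N t. \<Sum>n<N. u n t) (\<lambda>t. \<Sum>n. u n t) sequentially"
    proof (rule Weierstrass_m_test_ev[OF _ sm[OF d(1)]])
      show "\<forall>\<^sub>F n in sequentially. \<forall>t\<in>cball s d.
          norm (u n t) \<le> (norm s + d) * \<bar>b - b'\<bar> * real n powr (- d - 1)"
        using eventually_gt_at_top[of 0]
        by eventually_elim (use u_le Re d in blast)
    qed
    moreover have "cball s d \<subseteq> {s. Re s > 0}" using Re d by fastforce
    ultimately show "\<exists>d>0. cball s d \<subseteq> {s. Re s > 0} \<and>
        uniform_limit (cball s d) (\<lambda>N t. \<Sum>n<N. u n t) (\<lambda>t. \<Sum>n. u n t) sequentially"
      using d by blast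
  qed
  thus "(\<lambda>s. \<Sum>n. c n * (of_real (real n + b) powr (- s) - of_real (real n + b') powr (- s)))
           holomorphic_on {s. Re s > 0}" by (simp add: u_def)
qed

lemma eq_on_right_half_plane:
  assumes "f holomorphic_on {s. Re s > 0}" "g holomorphic_on {s. Re s > 0}"
    and "\<And>s. Re s > 1 \<Longrightarrow> f s = g s" and "Re s > 0"
  shows "f s = g s"
proof (rule analytic_continuation_open[of "{s. Re s > 1}" "{s. Re s > 0}" f g])
  have "2 \<in> {s. Re s > 1}" by simp
  thus "{s. Re s > 1} \<noteq> {}" by blast
  show "connected {s. Re s > 0}" by (intro convex_connected convex_halfspace_Re_gt)
qed (use assms in \<open>auto simp: open_halfspace_Re_gt\<close>)

text \<open>The paired series is holomorphic across s = 1. It therefore shows that the two poles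
  cancel and identifies the value that \<open>remove_sings\<close> inserts there.\<close>

lemma Y_zeta_series:
  fixes a :: real
  assumes a: "0 < a" "a < 1"
  defines "t \<equiv> (\<lambda>s n. of_real (real n + a) powr (- s) - of_real (real n + (1 - a)) powr (- s) :: complex)"
  shows "Y_zeta a holomorphic_on UNIV"
    and "\<And>s. Re s > 0 \<Longrightarrow> t s sums Y_zeta a s"
proof -
  obtain Z where Z: "Z holomorphic_on UNIV" "\<And>s. s \<noteq> 1 \<Longrightarrow> (s - 1) * hurwitz_zeta a s = Z s"
    "\<And>s. Re s > 1 \<Longrightarrow> hurwitz_zeta a s = lerch 1 s a"
    using hurwitz_zeta_continuation[of a] a by metis
  obtain Z' where Z': "Z' holomorphic_on UNIV" "\<And>s. s \<noteq> 1 \<Longrightarrow> (s - 1) * hurwitz_zeta (1 - a) s = Z' s"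
    "\<And>s. Re s > 1 \<Longrightarrow> hurwitz_zeta (1 - a) s = lerch 1 s (1 - a)"
    using hurwitz_zeta_continuation[of "1 - a"] a by auto
  define D where "D s = (\<Sum>n. t s n)" for s
  have t_sums: "t s sums D s" if "Re s > 0" for s
    using dirichlet_difference(1)[of "\<lambda>_. 1" a "1 - a" s] that a
    by (auto simp: t_def D_def intro!: summable_sums dest: summable_norm_cancel)
  have D_hol: "D holomorphic_on {s. Re s > 0}"
    using dirichlet_difference(2)[of "\<lambda>_. 1" a "1 - a"] a by (simp add: t_def D_def[abs_def])
  have D_eq: "(s - 1) * D s = Z s - Z' s" if "Re s > 0" for s
  proof (rule eq_on_right_half_plane[OF _ _ _ that])
    fix s assume s: "Re s > 1"
    have "(\<lambda>n. 1 ^ n * of_real (real n + a) powr (- s) - 1 ^ n * of_real (real n + (1 - a)) powr (- s)) sums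
        (lerch 1 s a - lerch 1 s (1 - a))"
      by (intro sums_diff lerch_sums) (use s a in auto)
    hence "t s sums (lerch 1 s a - lerch 1 s (1 - a))" by (simp add: t_def)
    with t_sums[of s] s have D: "D s = lerch 1 s a - lerch 1 s (1 - a)"
      using sums_unique2 by fastforce
    have "s \<noteq> 1" using s by auto
    moreover have "(s - 1) * D s = (s - 1) * hurwitz_zeta a s - (s - 1) * hurwitz_zeta (1 - a) s"
      by (simp add: D Z(3)[OF s] Z'(3)[OF s] right_diff_distrib)
    ultimately show "(s - 1) * D s = Z s - Z' s"
      by (simp only: Z(2) Z'(2) not_False_eq_True)
  qed (intro holomorphic_intros D_hol holomorphic_on_subset[OF Z(1)] holomorphic_on_subset[OF Z'(1)]; simp)+
  \<comment> \<open>\<open>G\<close> is entire by gluing: it is \<open>D\<close> on Re s > 0 and the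
    quotient away from 1, and these two open sets cover the plane.\<close>
  define G where "G s = (if s = 1 then D 1 else (Z s - Z' s) / (s - 1))" for s
  have GD: "G s = D s" if "Re s > 0" for s
    using D_eq[OF that] by (auto simp: G_def field_simps)
  have "G holomorphic_on {s. Re s > 0}"
    by (rule holomorphic_transform[OF D_hol]) (simp add: GD)
  moreover have "G holomorphic_on - {1}"
  proof (rule holomorphic_transform[of "\<lambda>s. (Z s - Z' s) / (s - 1)"])
    show "(\<lambda>s. (Z s - Z' s) / (s - 1)) holomorphic_on - {1}"
      by (intro holomorphic_intros holomorphic_on_subset[OF Z(1)] holomorphic_on_subset[OF Z'(1)]) auto
  qed (simp add: G_def)
  ultimately have "G holomorphic_on {s. Re s > 0} \<union> - {1}"
    by (intro holomorphic_on_Un) (auto simp: open_halfspace_Re_gt)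
  moreover have "{s. Re s > 0} \<union> - {1} = (UNIV :: complex set)" by auto
  ultimately have G_hol: "G holomorphic_on UNIV" by simp
  have "Y_zeta a s = G s" for s
    unfolding Y_zeta_def
  proof (rule remove_sings_eqI)
    have "isCont G s"
      using G_hol holomorphic_on_imp_continuous_on continuous_on_eq_continuous_at open_UNIV by blast
    hence lim: "G \<midarrow>s\<rightarrow> G s" by (simp add: isCont_def)
    have "\<forall>\<^sub>F w in at s. G w = hurwitz_zeta a w - hurwitz_zeta (1 - a) w"
    proof -
      have "\<forall>\<^sub>F w in at s. w \<noteq> 1" by (rule eventually_neq_at_within)
      thus ?thesis
      proof eventually_elim
        case (elim w)
        thus ?case using Z(2)[OF elim] Z'(2)[OF elim] by (simp add: G_def field_simps)
      qed
    qed
    with lim show "(\<lambda>s. hurwitz_zeta a s - hurwitz_zeta (1 - a) s) \<midarrow>s\<rightarrow> G s"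
      by (rule Lim_transform_eventually)
  qed
  hence YG: "Y_zeta a = G" by blast
  show "Y_zeta a holomorphic_on UNIV" using G_hol YG by simp
  show "t s sums Y_zeta a s" if "Re s > 0" for s
    using t_sums[OF that] GD[OF that] YG by simp
qed

text \<open>Summation by parts, so that the series converges absolutely for all positive $\Re s$.\<close>

lemma periodic_zeta_series:
  fixes a :: real
  assumes a: "0 < a" "a < 1"
  defines "z \<equiv> cis (2 * pi * a)"
  defines "t \<equiv> (\<lambda>s n. z ^ n * (of_real (real n + 1) powr (- s) - of_real (real n + 2) powr (- s)) :: complex)"
  assumes s: "Re s > 0"
  shows "t s sums ((z - (1 - z) * periodic_zeta a s) / z ^ 2)"
proof -
  have z: "norm z \<le> 1" "z \<noteq> 1" "z \<noteq> 0" "norm z = 1"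
    using cis_2pi_neq_1[OF a] by (simp_all add: z_def)
  define E where "E s = (\<Sum>n. t s n)" for s
  have t_sums: "t s sums E s" if "Re s > 0" for s
    using dirichlet_difference(1)[of "\<lambda>n. z ^ n" 1 2 s] that z
    by (auto simp: t_def E_def norm_power intro!: summable_sums dest: summable_norm_cancel)
  have E_hol: "E holomorphic_on {s. Re s > 0}"
    using dirichlet_difference(2)[of "\<lambda>n. z ^ n" 1 2] z by (simp add: t_def E_def[abs_def] norm_power)
  have "E s = (z - (1 - z) * periodic_zeta a s) / z ^ 2"
  proof (rule eq_on_right_half_plane[OF E_hol _ _ s])
    show "(\<lambda>s. (z - (1 - z) * periodic_zeta a s) / z ^ 2) holomorphic_on {s. Re s > 0}"
      by (intro holomorphic_intros holomorphic_on_subset[OF periodic_zeta_continuation(1)[OF a]])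
         (use z in auto)
    fix s assume s: "Re s > 1"
    define T where "T n = z ^ n * of_real (real n + 1) powr (- s)" for n
    have T: "T sums lerch z s 1" unfolding T_def by (rule lerch_sums) (use z s in auto)
    hence "(\<lambda>n. T (Suc n)) sums (lerch z s 1 - T 0)"
      using sums_Suc_iff[of T "lerch z s 1 - T 0"] by simp
    \<comment> \<open>Shifting the index turns the series of z^n (n+2)^(-s) into (lerch z s 1 - 1) /
      z. Multiplying by z^2 and using Li_s(z) = z lerch z s 1 gives the stated closed form.\<close>
    with T have "(\<lambda>n. T n - T (Suc n) / z) sums (lerch z s 1 - (lerch z s 1 - T 0) / z)"
      by (intro sums_diff sums_divide)
    also have "(\<lambda>n. T n - T (Suc n) / z) = t s"
      using z by (simp add: fun_eq_iff T_def t_def algebra_simps)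
    finally have "E s = lerch z s 1 - (lerch z s 1 - T 0) / z"
      using t_sums[of s] s sums_unique2 by fastforce
    hence zE: "z * E s = z * lerch z s 1 - (lerch z s 1 - 1)"
      using z by (simp add: T_def field_simps)
    have "z ^ 2 * E s = z - (1 - z) * periodic_zeta a s"
      unfolding power2_eq_square mult.assoc zE
      using periodic_zeta_continuation(2)[OF a s, folded z_def] by (simp add: algebra_simps)
    thus "E s = (z - (1 - z) * periodic_zeta a s) / z ^ 2"
      using z by (simp add: eq_divide_eq mult.commute)
  qed
  thus ?thesis using t_sums[OF s] by simp
qed

section \<open>Mellin transforms\<close>

text \<open>Restricting the space, instead of multiplying integrands by an indicator, lets pointwise
  identities valid only for x > 0 be used under the integral directly.\<close>

definition lborel_pos :: "real measure" where
  "lborel_pos = restrict_space lborel {0<..}"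

lemma space_lborel_pos [simp]: "space lborel_pos = {0<..}"
  by (simp add: lborel_pos_def space_restrict_space)

lemma measurable_lborel_pos [measurable (raw)]:
  "f \<in> borel_measurable borel \<Longrightarrow> f \<in> borel_measurable lborel_pos"
  unfolding lborel_pos_def by (rule measurable_restrict_space1) simp

lemma sigma_finite_lborel_pos: "sigma_finite_measure lborel_pos"
  unfolding lborel_pos_def
  by (intro sigma_finite_measure_restrict_space sigma_finite_lborel) simp

lemma nn_integral_lborel_pos:
  "nn_integral lborel_pos f = (\<integral>\<^sup>+x. f x * indicator {0<..} x \<partial>lborel)"
  unfolding lborel_pos_def by (rule nn_integral_restrict_space) simp

text \<open>The substitution t = c x in Euler's integral. The nonnegative version supplies
  integrability along with the value, and it is the form that can be used after Tonelli's
  theorem.\<close>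

lemma nn_integral_powr_exp:
  assumes s: "s > 0" and c: "c > 0"
  shows "(\<integral>\<^sup>+x. ennreal (x powr (s - 1) * exp (- c * x)) \<partial>lborel_pos) = ennreal (Gamma s * c powr (- s))"
proof -
  have "ennreal (Gamma s) = (\<integral>\<^sup>+t. ennreal (indicator {0..} t * t powr (s - 1) / exp t) \<partial>lborel)"
    using s by (rule Gamma_conv_nn_integral_real)
  also have "\<dots> = ennreal \<bar>c\<bar> *
      (\<integral>\<^sup>+t. ennreal (indicator {0..} (0 + c * t) * (0 + c * t) powr (s - 1) / exp (0 + c * t)) \<partial>lborel)"
    by (rule nn_integral_real_affine) (use c in auto)
  also have "(\<integral>\<^sup>+t. ennreal (indicator {0..} (0 + c * t) * (0 + c * t) powr (s - 1) / exp (0 + c * t)) \<partial>lborel)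
      = (\<integral>\<^sup>+t. ennreal (c powr (s - 1)) * (ennreal (t powr (s - 1) * exp (- c * t)) * indicator {0<..} t) \<partial>lborel)"
  proof (intro nn_integral_cong)
    fix t :: real
    show "ennreal (indicator {0..} (0 + c * t) * (0 + c * t) powr (s - 1) / exp (0 + c * t)) =
        ennreal (c powr (s - 1)) * (ennreal (t powr (s - 1) * exp (- c * t)) * indicator {0<..} t)"
      using c by (cases "t > 0")
        (auto simp: indicator_def powr_mult exp_minus field_simps zero_le_mult_iff simp flip: ennreal_mult)
  qed
  also have "\<dots> = ennreal (c powr (s - 1)) * (\<integral>\<^sup>+x. ennreal (x powr (s - 1) * exp (- c * x)) \<partial>lborel_pos)"
    by (subst nn_integral_cmult) (auto simp: nn_integral_lborel_pos)
  \<comment> \<open>Multiplying by c^(-s) cancels the factor c c^(s-1) and isolates the wanted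
    integral.\<close>
  finally have "ennreal (c powr (- s)) * ennreal (Gamma s) = ennreal (c powr (- s)) * (ennreal \<bar>c\<bar> *
      (ennreal (c powr (s - 1)) * (\<integral>\<^sup>+x. ennreal (x powr (s - 1) * exp (- c * x)) \<partial>lborel_pos)))"
    by simp
  also have "\<dots> = ennreal (c powr (- s) * (\<bar>c\<bar> * c powr (s - 1))) *
      (\<integral>\<^sup>+x. ennreal (x powr (s - 1) * exp (- c * x)) \<partial>lborel_pos)"
    by (simp add: ennreal_mult mult.assoc)
  also have "c powr (- s) * (\<bar>c\<bar> * c powr (s - 1)) = 1"
    using c by (simp add: powr_diff powr_minus field_simps)
  finally show ?thesis
    using s by (simp add: ennreal_mult Gamma_real_pos less_imp_le mult.commute)
qed

lemma has_bochner_integral_powr_exp: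
  assumes s: "s > 0" and c: "c > 0"
  shows "has_bochner_integral lborel_pos (\<lambda>x. x powr (s - 1) * exp (- c * x)) (Gamma s * c powr (- s))"
  by (rule has_bochner_integral_nn_integral[OF _ _ _ nn_integral_powr_exp[OF assms]])
     (use s in \<open>auto simp: Gamma_real_pos less_imp_le\<close>)

text \<open>A Beta integral: 1/(v+d) is the integral of exp(-(v+d)t) over t > 0. After exchanging
  the order, the integral over \<open>v\<close> gives Gamma(p) t^(-p), and that over
  \<open>t\<close> gives Gamma(1-p) d^(p-1).\<close>

lemma nn_integral_powr_over_add:
  assumes p: "0 < p" "p < 1" and d: "d > 0"
  shows "(\<integral>\<^sup>+v. ennreal (v powr (p - 1) / (v + d)) \<partial>lborel_pos) =
     ennreal (Gamma p * Gamma (1 - p) * d powr (p - 1))"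
proof -
  interpret sigma_finite_measure lborel_pos by (rule sigma_finite_lborel_pos)
  interpret P: pair_sigma_finite lborel_pos lborel_pos ..
  have inner: "ennreal (v powr (p - 1) / (v + d)) =
      (\<integral>\<^sup>+t. ennreal (v powr (p - 1) * exp (- (v + d) * t)) \<partial>lborel_pos)" if v: "v > 0" for v
  proof -
    have "(\<integral>\<^sup>+t. ennreal (v powr (p - 1) * exp (- (v + d) * t)) \<partial>lborel_pos) =
        (\<integral>\<^sup>+t. ennreal (v powr (p - 1)) * ennreal (t powr (1 - 1) * exp (- (v + d) * t)) \<partial>lborel_pos)"
      by (intro nn_integral_cong) (auto simp: ennreal_mult)
    also have "\<dots> = ennreal (v powr (p - 1)) * ennreal (Gamma 1 * (v + d) powr (- 1))"
      using nn_integral_powr_exp[of 1 "v + d"] v d by (subst nn_integral_cmult) auto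
    also have "\<dots> = ennreal (v powr (p - 1) / (v + d))"
      using v d by (simp add: powr_minus field_simps flip: ennreal_mult)
    finally show ?thesis ..
  qed
  have outer: "(\<integral>\<^sup>+v. ennreal (v powr (p - 1) * exp (- (v + d) * t)) \<partial>lborel_pos) =
      ennreal (Gamma p) * ennreal (t powr ((1 - p) - 1) * exp (- d * t))" if t: "t > 0" for t
  proof -
    have "(\<integral>\<^sup>+v. ennreal (v powr (p - 1) * exp (- (v + d) * t)) \<partial>lborel_pos) =
        (\<integral>\<^sup>+v. ennreal (exp (- d * t)) * ennreal (v powr (p - 1) * exp (- t * v)) \<partial>lborel_pos)"
      by (intro nn_integral_cong) (simp add: algebra_simps exp_add[symmetric] flip: ennreal_mult)
    also have "\<dots> = ennreal (exp (- d * t)) * ennreal (Gamma p * t powr (- p))"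
      using nn_integral_powr_exp[OF p(1) t] by (subst nn_integral_cmult) auto
    also have "\<dots> = ennreal (Gamma p) * ennreal (t powr ((1 - p) - 1) * exp (- d * t))"
      using p by (simp add: Gamma_real_pos less_imp_le mult_ac flip: ennreal_mult)
    finally show ?thesis .
  qed
  have "(\<integral>\<^sup>+v. ennreal (v powr (p - 1) / (v + d)) \<partial>lborel_pos) =
      (\<integral>\<^sup>+v. \<integral>\<^sup>+t. ennreal (v powr (p - 1) * exp (- (v + d) * t)) \<partial>lborel_pos \<partial>lborel_pos)"
    by (intro nn_integral_cong) (simp add: inner)
  also have "\<dots> = (\<integral>\<^sup>+t. \<integral>\<^sup>+v. ennreal (v powr (p - 1) * exp (- (v + d) * t)) \<partial>lborel_pos \<partial>lborel_pos)"
  proof (rule P.Fubini')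
    have [measurable]: "(\<lambda>x. fst x) \<in> borel_measurable (lborel_pos \<Otimes>\<^sub>M lborel_pos)"
      "(\<lambda>x. snd x) \<in> borel_measurable (lborel_pos \<Otimes>\<^sub>M lborel_pos)"
      by (auto intro: measurable_compose[OF measurable_fst] measurable_compose[OF measurable_snd]
          measurable_lborel_pos)
    show "(\<lambda>(t, v). ennreal (v powr (p - 1) * exp (- (v + d) * t)))
        \<in> borel_measurable (lborel_pos \<Otimes>\<^sub>M lborel_pos)"
      unfolding case_prod_unfold by measurable
  qed
  also have "\<dots> = (\<integral>\<^sup>+t. ennreal (Gamma p) * ennreal (t powr ((1 - p) - 1) * exp (- d * t)) \<partial>lborel_pos)"
    by (intro nn_integral_cong outer) simp
  also have "\<dots> = ennreal (Gamma p) * ennreal (Gamma (1 - p) * d powr (- (1 - p)))"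
    using nn_integral_powr_exp[of "1 - p" d] p d by (subst nn_integral_cmult) auto
  also have "\<dots> = ennreal (Gamma p * Gamma (1 - p) * d powr (p - 1))"
    using p by (simp add: Gamma_real_pos less_imp_le mult_ac flip: ennreal_mult)
  finally show ?thesis .
qed

text \<open>A bridge to the gauge integral, in whose terms the change of variables v = x^2 is
  carried out below.\<close>

lemma lborel_pos_iff_absolutely_integrable:
  fixes f :: "real \<Rightarrow> real"
  assumes f [measurable]: "f \<in> borel_measurable borel"
  shows "has_bochner_integral lborel_pos f I \<longleftrightarrow>
    f absolutely_integrable_on {0<..} \<and> integral {0<..} f = I"
proof -
  have [measurable]: "(\<lambda>x. indicator {0<..} x *\<^sub>R f x) \<in> borel_measurable lborel" by measurable
  have 1: "integrable lborel_pos f \<longleftrightarrow> f absolutely_integrable_on {0<..}"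
    unfolding lborel_pos_def set_integrable_def
    by (subst integrable_restrict_space) (auto simp: integrable_completion)
  have 2: "integral\<^sup>L lborel_pos f = integral {0<..} f" if "f absolutely_integrable_on {0<..}"
  proof -
    have "integral\<^sup>L lborel_pos f = (LINT x:{0<..}|lebesgue. f x)"
      unfolding lborel_pos_def set_lebesgue_integral_def
      by (subst integral_restrict_space) (auto simp: integral_completion)
    also have "\<dots> = integral {0<..} f"
      by (rule set_lebesgue_integral_eq_integral(2)[OF that])
    finally show ?thesis .
  qed
  show ?thesis using 1 2 by (auto simp: has_bochner_integral_iff)
qed

lemma Gamma_reflection_real:
  fixes p :: real
  assumes "0 < p" "p < 1"
  shows "Gamma p * Gamma (1 - p) = pi / sin (pi * p)"
proof -
  have "complex_of_real (Gamma p * Gamma (1 - p)) = of_real (pi / sin (pi * p))"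
    using Gamma_reflection_complex[of "of_real p"] by (simp add: Gamma_complex_of_real[symmetric] sin_of_real[symmetric])
  thus ?thesis by (simp only: of_real_eq_iff)
qed

text \<open>The preceding integral with p = s/2, d = c^2 and v = x^2. The Jacobian 2x accounts for
  the factor 1/2, and the reflection formula turns Gamma(s/2) Gamma(1 - s/2) into pi / sin(pi
  s/2).\<close>

lemma has_bochner_integral_powr_over_sum_squares:
  assumes s: "0 < s" "s < 2" and c: "c > 0"
  shows "has_bochner_integral lborel_pos (\<lambda>x. x powr (s - 1) / (x\<^sup>2 + c\<^sup>2))
           (pi / (2 * sin (pi * s / 2)) * c powr (s - 2))"
proof -
  define I where "I = pi / (2 * sin (pi * s / 2)) * c powr (s - 2)"
  define f where "f v = v powr (s / 2 - 1) / (v + c\<^sup>2)" for v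
  have f_meas: "f \<in> borel_measurable borel" unfolding f_def by measurable
  have "ennreal (Gamma (s/2) * Gamma (1 - s/2) * (c\<^sup>2) powr (s/2 - 1)) = ennreal (2 * I)"
  proof -
    have "(c\<^sup>2) powr (s/2 - 1) = c powr (s - 2)"
      using c by (simp add: powr_powr diff_divide_distrib flip: powr_numeral)
    thus ?thesis using Gamma_reflection_real[of "s/2"] s by (simp add: I_def)
  qed
  moreover have I: "I \<ge> 0"
    unfolding I_def using s by (intro mult_nonneg_nonneg divide_nonneg_nonneg) (auto intro!: sin_ge_zero)
  ultimately have "has_bochner_integral lborel_pos f (2 * I)"
    using nn_integral_powr_over_add[of "s/2" "c\<^sup>2"] s c unfolding f_def
    by (intro has_bochner_integral_nn_integral) auto
  hence f: "f absolutely_integrable_on {0<..} \<and> integral {0<..} f = 2 * I"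
    by (subst (asm) lborel_pos_iff_absolutely_integrable[OF f_meas])
  have img: "(\<lambda>x::real. x\<^sup>2) ` {0<..} = {0<..}"
  proof (intro equalityI subsetI)
    fix y :: real assume "y \<in> {0<..}"
    hence "y = (sqrt y)\<^sup>2" "sqrt y \<in> {0<..}" by auto
    thus "y \<in> (\<lambda>x. x\<^sup>2) ` {0<..}" by blast
  qed auto
  have "(\<lambda>x. \<bar>2 * x\<bar> * f (x\<^sup>2)) absolutely_integrable_on {0<..} \<and>
      integral {0<..} (\<lambda>x. \<bar>2 * x\<bar> * f (x\<^sup>2)) = 2 * I \<longleftrightarrow>
      f absolutely_integrable_on (\<lambda>x. x\<^sup>2) ` {0<..} \<and> integral ((\<lambda>x. x\<^sup>2) ` {0<..}) f = 2 * I"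
  proof (rule has_absolute_integral_change_of_variables_1')
    show "inj_on (\<lambda>x::real. x\<^sup>2) {0<..}" by (auto simp: inj_on_def power2_eq_iff)
    show "((\<lambda>x. x\<^sup>2) has_field_derivative 2 * x) (at x within {0<..})" for x :: real
      by (auto intro!: derivative_eq_intros)
  qed auto
  hence "has_bochner_integral lborel_pos (\<lambda>x. \<bar>2 * x\<bar> * f (x\<^sup>2)) (2 * I)"
    using f_meas f unfolding img by (subst lborel_pos_iff_absolutely_integrable) auto
  hence "has_bochner_integral lborel_pos (\<lambda>x. \<bar>2 * x\<bar> * f (x\<^sup>2) / 2) (2 * I / 2)"
    by (rule has_bochner_integral_divide)
  moreover have "\<bar>2 * x\<bar> * f (x\<^sup>2) / 2 = x powr (s - 1) / (x\<^sup>2 + c\<^sup>2)" if x: "x > 0" for x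
  proof -
    have "x * (x\<^sup>2) powr (s/2 - 1) = x powr 1 * x powr (2 * (s/2 - 1))"
      using x by (simp add: powr_powr flip: powr_numeral)
    also have "\<dots> = x powr (1 + 2 * (s/2 - 1))" by (rule powr_add[symmetric])
    also have "1 + 2 * (s/2 - 1) = s - 1" by simp
    finally have "x * (x\<^sup>2) powr (s/2 - 1) = x powr (s - 1)" .
    moreover have "2 * x * (A / B) / 2 = x * A / B" for A B :: real by simp
    ultimately show ?thesis using x by (simp only: f_def abs_mult abs_numeral abs_of_pos)
  qed
  ultimately show ?thesis
    unfolding I_def[symmetric]
    by (subst has_bochner_integral_cong[where g = "\<lambda>x. \<bar>2 * x\<bar> * f (x\<^sup>2) / 2" and N = lborel_pos and y = I]) auto
qed

text \<open>Integrating the geometric series of the kernel directly would produce norms Gamma(s)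
  (n+1)^(-s), not summable for s \<le> 1. Consecutive exponentials are paired instead:
  \<open>g n\<close> is nonnegative on x > 0 and its integrals telescope, so the exchange is
  legitimate for every s > 0.\<close>

lemma periodic_zeta_Mellin:
  fixes a s :: real
  assumes a: "0 < a" "a < 1" and s: "s > 0"
  defines "z \<equiv> cis (2 * pi * a)"
  shows "has_bochner_integral lborel_pos
    (\<lambda>x. of_real (x powr (s - 1)) * (z * of_real (exp (- x)) / (1 - z * of_real (exp (- x)))))
    (of_real (Gamma s) * periodic_zeta a (of_real s))"
proof -
  have z: "norm z = 1" "z \<noteq> 1" "z \<noteq> 0"
    using cis_2pi_neq_1[OF a] by (simp_all add: z_def)
  define q where "q n = (real n + 1) powr (- s)" for n
  define g where "g n x = x powr (s - 1) * exp (- (real n + 1) * x) - x powr (s - 1) * exp (- (real n + 2) * x)"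
    for n x
  define f where "f n x = z ^ n * of_real (g n x)" for n x
  \<comment> \<open>The closed form of the sum of all \<open>f n x\<close>, by the geometric series
    in z exp(-x).\<close>
  define H where "H x = of_real (x powr (s - 1)) *
      (of_real (exp (- x)) * (1 - of_real (exp (- x))) / (1 - z * of_real (exp (- x))))" for x
  define E where "E = (z - (1 - z) * periodic_zeta a (of_real s)) / z ^ 2"
  have g_int: "has_bochner_integral lborel_pos (g n) (Gamma s * (q n - q (Suc n)))" for n
    using has_bochner_integral_diff[OF has_bochner_integral_powr_exp[OF s, of "real n + 1"]
        has_bochner_integral_powr_exp[OF s, of "real n + 2"]]
    by (simp add: g_def[abs_def] q_def algebra_simps)
  have f_int: "has_bochner_integral lborel_pos (f n) (z ^ n * of_real (Gamma s * (q n - q (Suc n))))" for n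
    unfolding f_def by (intro has_bochner_integral_mult_right has_bochner_integral_of_real g_int)
  have g_nonneg: "g n x \<ge> 0" if "x > 0" for n x
    using that by (auto simp: g_def intro!: mult_left_mono)
  have norm_f: "norm (f n x) = g n x" if "x > 0" for n x
    using g_nonneg[OF that, of n] z by (simp add: f_def norm_mult norm_power)
  have f_sums: "f n x = of_real (x powr (s - 1) * exp (- x) * (1 - exp (- x))) * (z * of_real (exp (- x))) ^ n"
    for n x
  proof -
    have "exp (- (real n + 1) * x) = exp (- x) * exp (- x) ^ n"
      by (simp add: exp_of_nat_mult[symmetric] algebra_simps flip: exp_add)
    moreover have "exp (- (real n + 2) * x) = exp (- x) * exp (- x) * exp (- x) ^ n"
      by (simp add: exp_of_nat_mult[symmetric] algebra_simps flip: exp_add)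
    ultimately have "g n x = x powr (s - 1) * exp (- x) * (1 - exp (- x)) * exp (- x) ^ n"
      by (simp only: g_def) (simp add: algebra_simps)
    thus ?thesis by (simp add: f_def power_mult_distrib)
  qed
  have ze: "norm (z * of_real (exp (- x))) < 1" if "x > 0" for x
    using z that by (simp add: norm_mult)
  have f_sum: "(\<Sum>n. f n x) = H x" if "x > 0" for x
  proof -
    have "(\<lambda>n. f n x) sums (of_real (x powr (s - 1) * exp (- x) * (1 - exp (- x))) *
        (1 / (1 - z * of_real (exp (- x)))))"
      unfolding f_sums by (intro sums_mult geometric_sums ze that)
    thus ?thesis by (simp add: sums_iff H_def)
  qed
  have q_sums: "(\<lambda>n. q n - q (Suc n)) sums (q 0 - 0)"
  proof (rule telescope_sums')
    show "q \<longlonglongrightarrow> 0" unfolding q_def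
      by (rule tendsto_neg_powr[of "- s" "\<lambda>n. real n + 1"])
         (use s in \<open>auto intro!: filterlim_tendsto_add_at_top[OF tendsto_const]
            filterlim_real_sequentially simp: add.commute[of _ 1]\<close>)
  qed
  have int_f: "integrable lborel_pos (f n)" for n using f_int[of n] by (simp add: has_bochner_integral_iff)
  have AE: "AE x in lborel_pos. summable (\<lambda>n. norm (f n x))"
  proof (rule AE_I2)
    fix x assume "x \<in> space lborel_pos"
    hence x: "x > 0" by simp
    have "summable (\<lambda>n. norm (of_real (x powr (s - 1) * exp (- x) * (1 - exp (- x))) :: complex) *
        norm (z * of_real (exp (- x))) ^ n)"
      using ze[OF x] by (intro summable_mult summable_geometric) simp
    thus "summable (\<lambda>n. norm (f n x))" unfolding f_sums norm_mult norm_power .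
  qed
  have sm: "summable (\<lambda>n. \<integral>x. norm (f n x) \<partial>lborel_pos)"
  proof -
    have "(\<integral>x. norm (f n x) \<partial>lborel_pos) = Gamma s * (q n - q (Suc n))" for n
    proof -
      have "(\<integral>x. norm (f n x) \<partial>lborel_pos) = (\<integral>x. g n x \<partial>lborel_pos)"
        by (rule Bochner_Integration.integral_cong) (auto simp: norm_f)
      thus ?thesis using g_int[of n] by (simp add: has_bochner_integral_iff)
    qed
    thus ?thesis using sums_summable[OF q_sums] by (simp add: summable_mult)
  qed
  have H_cong: "has_bochner_integral lborel_pos (\<lambda>x. \<Sum>n. f n x) I \<longleftrightarrow> has_bochner_integral lborel_pos H I" for I
    by (rule has_bochner_integral_cong) (auto simp: f_sum)
  have "(\<lambda>n. z ^ n * of_real (Gamma s * (q n - q (Suc n)))) sums (\<integral>x. (\<Sum>n. f n x) \<partial>lborel_pos)"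
    using sums_integral[OF int_f AE sm] f_int by (simp add: has_bochner_integral_iff)
  moreover have "(\<lambda>n. z ^ n * of_real (Gamma s * (q n - q (Suc n)))) sums (of_real (Gamma s) * E)"
  proof -
    have "(\<lambda>n. z ^ n * (of_real (real n + 1) powr (- of_real s) - of_real (real n + 2) powr (- of_real s)))
        sums E"
      unfolding E_def z_def by (rule periodic_zeta_series[OF a]) (use s in simp)
    hence "(\<lambda>n. of_real (Gamma s) * (z ^ n * (of_real (real n + 1) powr (- of_real s) -
        of_real (real n + 2) powr (- of_real s)))) sums (of_real (Gamma s) * E)"
      by (rule sums_mult)
    moreover have "of_real (real n + 1) powr (- of_real s) = (of_real (q n) :: complex)"
      "of_real (real n + 2) powr (- of_real s) = (of_real (q (Suc n)) :: complex)" for n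
      by (simp_all add: q_def powr_of_real[symmetric] del: of_real_add) (simp_all add: add.commute)
    ultimately show ?thesis by (simp add: mult_ac)
  qed
  ultimately have "(\<integral>x. (\<Sum>n. f n x) \<partial>lborel_pos) = of_real (Gamma s) * E"
    by (rule sums_unique2)
  with integrable_suminf[OF int_f AE sm] have H: "has_bochner_integral lborel_pos H (of_real (Gamma s) * E)"
    unfolding H_cong[symmetric] by (simp add: has_bochner_integral_iff)
  have L: "has_bochner_integral lborel_pos (\<lambda>x. of_real (x powr (s - 1) * exp (- 1 * x)) :: complex)
      (of_real (Gamma s * 1 powr (- s)))"
    by (intro has_bochner_integral_of_real has_bochner_integral_powr_exp s) simp
  \<comment> \<open>The pairing is undone: solving the definition of \<open>E\<close> for the
    periodic zeta value gives (z - z^2 E) / (1 - z), and the same combination of exp(-x) and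
    \<open>H\<close> is the original kernel.\<close>
  have "has_bochner_integral lborel_pos
     (\<lambda>x. (z * of_real (x powr (s - 1) * exp (- 1 * x)) - z ^ 2 * H x) / (1 - z))
     ((z * of_real (Gamma s * 1 powr (- s)) - z ^ 2 * (of_real (Gamma s) * E)) / (1 - z))"
    by (intro has_bochner_integral_divide has_bochner_integral_diff has_bochner_integral_mult_right H L)
  moreover have "(z * of_real (Gamma s * 1 powr (- s)) - z ^ 2 * (of_real (Gamma s) * E)) / (1 - z) =
      of_real (Gamma s) * periodic_zeta a (of_real s)"
  proof -
    have "z ^ 2 * (of_real (Gamma s) * E) = of_real (Gamma s) * (z - (1 - z) * periodic_zeta a (of_real s))"
      using z by (simp add: E_def)
    thus ?thesis using z by (simp add: divide_eq_eq right_diff_distrib mult_ac)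
  qed
  moreover have "(z * of_real (x powr (s - 1) * exp (- 1 * x)) - z ^ 2 * H x) / (1 - z) =
      of_real (x powr (s - 1)) * (z * of_real (exp (- x)) / (1 - z * of_real (exp (- x))))" if "x > 0" for x
  proof -
    define e where "e = complex_of_real (exp (- x))"
    define r where "r = complex_of_real (x powr (s - 1))"
    have ne: "1 - z * e \<noteq> 0" "1 - z \<noteq> 0" using ze[OF that] z by (auto simp: e_def)
    have "z * (r * e) - z ^ 2 * (r * (e * (1 - e) / (1 - z * e))) = (1 - z) * (r * (z * e / (1 - z * e)))"
      using ne(1) by (simp add: field_simps power2_eq_square)
    hence "(z * (r * e) - z ^ 2 * (r * (e * (1 - e) / (1 - z * e)))) / (1 - z) = r * (z * e / (1 - z * e))"
      using ne(2) by (simp add: divide_eq_eq mult_ac)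
    thus ?thesis by (simp add: H_def e_def r_def)
  qed
  ultimately show ?thesis
    by (subst has_bochner_integral_cong[where N = lborel_pos and y = "of_real (Gamma s) * periodic_zeta a (of_real s)"
          and g = "\<lambda>x. (z * of_real (x powr (s - 1) * exp (- 1 * x)) - z ^ 2 * H x) / (1 - z)"]) auto
qed

text \<open>Replacing a by 1 - a conjugates \<open>z\<close> and hence the kernel. So - i times the
  difference of the two kernels is twice an imaginary part, which simplifies to sin \<theta> / (cosh
  x - cos \<theta>).\<close>

lemma O_zeta_Mellin:
  fixes a s :: real
  assumes a: "0 < a" "a < 1" and s: "s > 0"
  defines "\<theta> \<equiv> 2 * pi * a"
  defines "K \<equiv> (\<lambda>x. x powr (s - 1) * (sin \<theta> / (cosh x - cos \<theta>)))"
  shows "integrable lborel_pos K"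
    and "of_real (Gamma s) * O_zeta a (of_real s) = of_real (integral\<^sup>L lborel_pos K)"
proof -
  define z where "z = cis \<theta>"
  have cis': "cis (2 * pi * (1 - a)) = cnj z"
  proof -
    have "cis (2 * pi * (1 - a)) = cis (2 * pi) * cis (- \<theta>)"
      unfolding cis_mult by (simp add: \<theta>_def algebra_simps)
    thus ?thesis by (simp add: z_def cis_cnj)
  qed
  define w where "w x = z * of_real (exp (- x)) / (1 - z * of_real (exp (- x)))" for x
  have M1: "has_bochner_integral lborel_pos (\<lambda>x. of_real (x powr (s - 1)) * w x)
      (of_real (Gamma s) * periodic_zeta a (of_real s))"
    using periodic_zeta_Mellin[OF a s] by (simp add: w_def[abs_def] z_def \<theta>_def)
  have M2: "has_bochner_integral lborel_pos (\<lambda>x. of_real (x powr (s - 1)) * cnj (w x))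
      (of_real (Gamma s) * periodic_zeta (1 - a) (of_real s))"
    using periodic_zeta_Mellin[of "1 - a" s] a s by (simp add: w_def[abs_def] cis')
  have "has_bochner_integral lborel_pos
      (\<lambda>x. - \<i> * (of_real (x powr (s - 1)) * w x - of_real (x powr (s - 1)) * cnj (w x)))
      (- \<i> * (of_real (Gamma s) * periodic_zeta a (of_real s) - of_real (Gamma s) * periodic_zeta (1 - a) (of_real s)))"
    by (intro has_bochner_integral_mult_right has_bochner_integral_diff M1 M2)
  also have "- \<i> * (of_real (Gamma s) * periodic_zeta a (of_real s) - of_real (Gamma s) * periodic_zeta (1 - a) (of_real s))
      = of_real (Gamma s) * O_zeta a (of_real s)"
    by (simp add: O_zeta_def algebra_simps)
  finally have M: "has_bochner_integral lborel_pos
      (\<lambda>x. - \<i> * (of_real (x powr (s - 1)) * w x - of_real (x powr (s - 1)) * cnj (w x)))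
      (of_real (Gamma s) * O_zeta a (of_real s))" .
  have ker: "- \<i> * (of_real (x powr (s - 1)) * w x - of_real (x powr (s - 1)) * cnj (w x)) =
      complex_of_real (K x)" if x: "x > 0" for x
  proof -
    define e where "e = exp (- x)"
    have e: "0 < e" "e < 1" using x by (auto simp: e_def)
    have cosh: "cosh x = (1 + e\<^sup>2) / (2 * e)"
      by (simp add: cosh_def e_def exp_minus field_simps power2_eq_square)
    \<comment> \<open>The left-hand side is |1 - z e|^2, the denominator of
      \<open>Im (w x)\<close>.\<close>
    have den: "(1 - e * cos \<theta>)\<^sup>2 + (e * sin \<theta>)\<^sup>2 = 2 * e * (cosh x - cos \<theta>)"
    proof -
      have "(1 - e * cos \<theta>)\<^sup>2 + (e * sin \<theta>)\<^sup>2 = 1 - 2 * e * cos \<theta> + e\<^sup>2 * ((sin \<theta>)\<^sup>2 + (cos \<theta>)\<^sup>2)"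
        by algebra
      also have "\<dots> = 2 * e * (cosh x - cos \<theta>)"
        using e by (simp add: cosh field_simps)
      finally show ?thesis .
    qed
    have "Im (w x) = e * sin \<theta> / ((1 - e * cos \<theta>)\<^sup>2 + (e * sin \<theta>)\<^sup>2)"
      by (simp add: w_def z_def Im_divide e_def[symmetric] mult.commute[of _ e])
         (simp add: algebra_simps)
    also have "\<dots> = sin \<theta> / (cosh x - cos \<theta>) / 2"
      unfolding den using e by simp
    finally have im: "Im (w x) = sin \<theta> / (cosh x - cos \<theta>) / 2" .
    have "2 * (t / 2) = t" for t :: real by simp
    hence "2 * Im (w x) = sin \<theta> / (cosh x - cos \<theta>)" unfolding im .
    hence "- \<i> * (w x - cnj (w x)) = of_real (sin \<theta> / (cosh x - cos \<theta>))"
      by (simp add: complex_eq_iff)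
    hence "of_real (x powr (s - 1)) * (- \<i> * (w x - cnj (w x))) = complex_of_real (K x)"
      by (simp add: K_def)
    thus ?thesis by (simp add: algebra_simps)
  qed
  have "has_bochner_integral lborel_pos (\<lambda>x. complex_of_real (K x)) (of_real (Gamma s) * O_zeta a (of_real s))"
    using M by (subst (asm) has_bochner_integral_cong[OF refl ker refl]) auto
  thus "integrable lborel_pos K"
    and "of_real (Gamma s) * O_zeta a (of_real s) = of_real (integral\<^sup>L lborel_pos K)"
    by (simp_all add: has_bochner_integral_iff complex_of_real_integrable_eq)
qed

text \<open>For 0 < a < 1/2 the angle \<theta> lies in (0, pi), so the kernel is strictly positive
  on x > 0. A vanishing integral would force it to be 0 almost everywhere on a set of positive
  measure.\<close>

lemma O_zeta_pos:
  fixes a s :: real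
  assumes a: "0 < a" "a < 1 / 2" and s: "s > 0"
  obtains r where "r > 0" "O_zeta a (of_real s) = of_real r"
proof -
  define \<theta> where "\<theta> = 2 * pi * a"
  define K where "K x = x powr (s - 1) * (sin \<theta> / (cosh x - cos \<theta>))" for x
  have a1: "a < 1" using a by simp
  note Mellin = O_zeta_Mellin[OF a(1) a1 s, folded \<theta>_def, folded K_def]
  have "sin \<theta> > 0" using a by (intro sin_gt_zero) (auto simp: \<theta>_def)
  moreover have "cosh x - cos \<theta> > 0" if "x > 0" for x
  proof -
    have "1 < cosh x" using cosh_real_strict_mono[of 0 x] that by simp
    thus ?thesis using cos_le_one[of \<theta>] by linarith
  qed
  ultimately have K: "K x > 0" if "x > 0" for x
    using that by (simp add: K_def)
  have "integral\<^sup>L lborel_pos K \<noteq> 0"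
  proof
    assume "integral\<^sup>L lborel_pos K = 0"
    hence "AE x in lborel_pos. K x = 0"
      using K Mellin(1) by (subst (asm) integral_nonneg_eq_0_iff_AE) (auto intro!: AE_I2 less_imp_le)
    hence "AE x in lborel_pos. False"
      using AE_space by eventually_elim (use K in force)
    hence "emeasure lborel_pos {0<..} = 0"
      by (simp add: eventually_False ae_filter_eq_bot_iff)
    hence "emeasure lborel {0::real<..} = 0" by (simp add: lborel_pos_def emeasure_restrict_space)
    moreover have "emeasure lborel {0<..<1::real} \<le> emeasure lborel {0::real<..}"
      by (rule emeasure_mono) auto
    ultimately show False by simp
  qed
  moreover have "integral\<^sup>L lborel_pos K \<ge> 0"
    by (intro Bochner_Integration.integral_nonneg_AE AE_I2) (use K in \<open>auto intro: less_imp_le\<close>)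
  ultimately have "integral\<^sup>L lborel_pos K / Gamma s > 0"
    using s by (simp add: Gamma_real_pos)
  moreover have "O_zeta a (of_real s) = of_real (integral\<^sup>L lborel_pos K / Gamma s)"
    using Mellin(2) Gamma_real_pos[OF s] by (simp add: field_simps)
  ultimately show ?thesis using that by blast
qed

section \<open>The functional equation\<close>

text \<open>The logarithmic derivative of the reflection formula: Gamma(u) Gamma(1-u) sin(pi u) is
  constant, so pi cot(pi w) = Digamma(1-w) - Digamma(w), and subtracting the two Digamma series
  gives the sum. For 0 < Re w < 1 neither argument is a pole.\<close>

lemma pi_cot_partial_fractions:
  assumes w: "0 < Re w" "Re w < 1"
  shows "(\<lambda>n. inverse (w + of_nat n) - inverse (1 - w + of_nat n)) sums
           (of_real pi * (cos (of_real pi * w) / sin (of_real pi * w)))"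
proof -
  have "u \<notin> \<int>\<^sub>\<le>\<^sub>0" if "Re u > 0" for u using that by (auto elim!: nonpos_Ints_cases)
  hence nonint: "w \<notin> \<int>\<^sub>\<le>\<^sub>0" "1 - w \<notin> \<int>\<^sub>\<le>\<^sub>0" using w by auto
  have w0: "w \<noteq> 0" "1 - w \<noteq> 0" using w by auto
  have G: "Gamma w \<noteq> 0" "Gamma (1 - w) \<noteq> 0" using nonint by (auto simp: Gamma_eq_zero_iff)
  have sn: "sin (of_real pi * w) \<noteq> 0"
  proof
    assume "sin (of_real pi * w) = 0"
    hence "Gamma w * Gamma (1 - w) = 0" by (simp add: Gamma_reflection_complex)
    thus False using G by simp
  qed
  have "((\<lambda>u. Gamma u * Gamma (1 - u) * sin (of_real pi * u)) has_field_derivative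
      Gamma w * Gamma (1 - w) * (of_real pi * cos (of_real pi * w)) +
      (Gamma w * (- (Gamma (1 - w) * Digamma (1 - w))) + (Gamma w * Digamma w) * Gamma (1 - w)) *
        sin (of_real pi * w)) (at w)"
    using nonint by (auto intro!: derivative_eq_intros)
  moreover have "((\<lambda>u. Gamma u * Gamma (1 - u) * sin (of_real pi * u)) has_field_derivative 0) (at w)"
  proof (rule has_field_derivative_transform_within_open)
    show "((\<lambda>_. of_real pi) has_field_derivative 0) (at w)" by simp
    show "open {u. sin (of_real pi * u) \<noteq> (0 :: complex)}"
      by (intro open_Collect_neq continuous_intros)
  qed (use sn in \<open>auto simp: Gamma_reflection_complex\<close>)
  ultimately have "Gamma w * Gamma (1 - w) * (of_real pi * cos (of_real pi * w)) +
      (Gamma w * (- (Gamma (1 - w) * Digamma (1 - w))) + (Gamma w * Digamma w) * Gamma (1 - w)) *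
        sin (of_real pi * w) = 0"
    by (rule DERIV_unique)
  hence "Gamma w * Gamma (1 - w) * (of_real pi * cos (of_real pi * w) -
      (Digamma (1 - w) - Digamma w) * sin (of_real pi * w)) = 0"
    by (simp add: algebra_simps)
  hence eq: "of_real pi * cos (of_real pi * w) = (Digamma (1 - w) - Digamma w) * sin (of_real pi * w)"
    using G by simp
  have "(\<lambda>n. (inverse (of_nat (Suc n)) - inverse (1 - w + of_nat n)) -
      (inverse (of_nat (Suc n)) - inverse (w + of_nat n))) sums
      ((Digamma (1 - w) + euler_mascheroni) - (Digamma w + euler_mascheroni))"
    using summable_sums[OF summable_Digamma[OF w0(1)]] summable_sums[OF summable_Digamma[OF w0(2)]]
    by (intro sums_diff) (simp_all add: Digamma_def)
  hence "(\<lambda>n. inverse (w + of_nat n) - inverse (1 - w + of_nat n)) sums (Digamma (1 - w) - Digamma w)"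
    by (simp add: algebra_simps)
  moreover have "of_real pi * (cos (of_real pi * w) / sin (of_real pi * w)) = Digamma (1 - w) - Digamma w"
    using eq sn by (simp add: divide_eq_eq)
  ultimately show ?thesis by (simp only:)
qed

text \<open>The real part of the cotangent expansion at w = a + i x/(2 pi), rescaled by
  1/pi.\<close>

lemma sin_over_cosh_partial_fractions:
  fixes a x :: real
  assumes a: "0 < a" "a < 1"
  defines "c \<equiv> (\<lambda>n. 2 * pi * (real n + a))" and "c' \<equiv> (\<lambda>n. 2 * pi * (real n + (1 - a)))"
  shows "(\<lambda>n. 2 * (c n / (x\<^sup>2 + (c n)\<^sup>2) - c' n / (x\<^sup>2 + (c' n)\<^sup>2))) sums
           (sin (2 * pi * a) / (cosh x - cos (2 * pi * a)))"
proof -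
  define y where "y = x / (2 * pi)"
  have x: "x = 2 * pi * y" by (simp add: y_def)
  define w where "w = Complex a y"
  have "(\<lambda>n. Re (inverse (w + of_nat n) - inverse (1 - w + of_nat n))) sums
      Re (of_real pi * (cos (of_real pi * w) / sin (of_real pi * w)))"
    by (intro sums_Re pi_cot_partial_fractions) (use a in \<open>simp_all add: w_def\<close>)
  hence "(\<lambda>n. 1 / pi * Re (inverse (w + of_nat n) - inverse (1 - w + of_nat n))) sums
      (1 / pi * Re (of_real pi * (cos (of_real pi * w) / sin (of_real pi * w))))"
    by (rule sums_mult)
  moreover have "1 / pi * Re (inverse (w + of_nat n) - inverse (1 - w + of_nat n)) =
      2 * (c n / (x\<^sup>2 + (c n)\<^sup>2) - c' n / (x\<^sup>2 + (c' n)\<^sup>2))" for n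
  proof -
    have scale: "2 * (2 * pi * m / ((2 * pi * y)\<^sup>2 + (2 * pi * m)\<^sup>2)) = 1 / pi * (m / (m\<^sup>2 + y\<^sup>2))" for m
    proof -
      have "(2 * pi * y)\<^sup>2 + (2 * pi * m)\<^sup>2 = (4 * pi * pi) * (m\<^sup>2 + y\<^sup>2)"
        by (simp add: power2_eq_square algebra_simps)
      thus ?thesis by (simp only:) simp
    qed
    have "Re (inverse (w + of_nat n) - inverse (1 - w + of_nat n)) =
        (real n + a) / ((real n + a)\<^sup>2 + y\<^sup>2) - (real n + (1 - a)) / ((real n + (1 - a))\<^sup>2 + y\<^sup>2)"
      by (simp add: w_def add_ac)
    thus ?thesis
      by (simp only: c_def c'_def x right_diff_distrib[of 2] scale) (simp add: right_diff_distrib)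
  qed
  moreover have "1 / pi * Re (of_real pi * (cos (of_real pi * w) / sin (of_real pi * w))) =
      sin (2 * pi * a) / (cosh x - cos (2 * pi * a))"
  proof -
    \<comment> \<open>In these variables all remaining claims are polynomial identities modulo S^2 +
      C^2 = 1 and p q = 1.\<close>
    define S C where "S = sin (pi * a)" and "C = cos (pi * a)"
    define p q where "p = exp (pi * y)" and "q = exp (- (pi * y))"
    have pq: "p * q = 1" by (simp add: p_def q_def flip: exp_add)
    have SC: "S\<^sup>2 + C\<^sup>2 = 1" by (simp add: S_def C_def)
    have cosh: "cosh x = (p\<^sup>2 + q\<^sup>2) / 2"
      by (simp add: cosh_def x p_def q_def power2_eq_square mult.assoc flip: exp_add)
    have s2: "sin (2 * pi * a) = 2 * S * C" "cos (2 * pi * a) = C\<^sup>2 - S\<^sup>2"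
      using sin_double[of "pi * a"] cos_double[of "pi * a"] by (simp_all add: S_def C_def mult.assoc)
    have Re_cos: "Re (cos (of_real pi * w)) = C * (p + q) / 2" "Im (cos (of_real pi * w)) = S * (q - p) / 2"
      and Re_sin: "Re (sin (of_real pi * w)) = S * (p + q) / 2" "Im (sin (of_real pi * w)) = C * (p - q) / 2"
      by (simp_all add: Re_cos Im_cos Re_sin Im_sin w_def S_def C_def p_def q_def)
    have num: "Re (cos (of_real pi * w)) * Re (sin (of_real pi * w)) +
        Im (cos (of_real pi * w)) * Im (sin (of_real pi * w)) = S * C"
    proof -
      have "(C * (p + q) / 2) * (S * (p + q) / 2) + (S * (q - p) / 2) * (C * (p - q) / 2) = S * C * (p * q)"
        by (simp add: field_simps)
      thus ?thesis by (simp only: Re_cos Re_sin pq mult_1_right)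
    qed
    have den: "(Re (sin (of_real pi * w)))\<^sup>2 + (Im (sin (of_real pi * w)))\<^sup>2 =
        (cosh x - cos (2 * pi * a)) / 2"
    proof -
      have "(S * (p + q) / 2)\<^sup>2 + (C * (p - q) / 2)\<^sup>2 =
          ((S\<^sup>2 + C\<^sup>2) * (p\<^sup>2 + q\<^sup>2) - 2 * (p * q) * (C\<^sup>2 - S\<^sup>2)) / 4"
        by (simp add: field_simps power2_eq_square)
      thus ?thesis by (simp only: Re_sin SC pq cosh s2) simp
    qed
    have "Re (cos (of_real pi * w) / sin (of_real pi * w)) = S * C / ((cosh x - cos (2 * pi * a)) / 2)"
      by (simp only: Re_divide num den)
    moreover have "1 / pi * Re (of_real pi * u) = Re u" for u :: complex by simp
    ultimately show ?thesis by (simp only: s2(1)) simp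
  qed
  ultimately show ?thesis by simp
qed

text \<open>Each partial fraction c/(x^2 + c^2) has a Mellin transform proportional to c^(s-1). With
  c = 2 pi (n+a) and c = 2 pi (n+1-a), the differences are the terms of \<open>Y\<close> at 1 - s up
  to a common factor.\<close>

lemma O_zeta_functional_equation_strip:
  fixes a s :: real
  assumes a: "0 < a" "a < 1 / 2" and s: "0 < s" "s < 1"
  shows "of_real (Gamma s) * O_zeta a (of_real s) =
    of_real (pi / sin (pi * s / 2) * (2 * pi) powr (s - 1)) * Y_zeta a (1 - of_real s)"
proof -
  define c c' where "c n = 2 * pi * (real n + a)" and "c' n = 2 * pi * (real n + (1 - a))" for n
  define \<kappa> where "\<kappa> = pi / (2 * sin (pi * s / 2))"
  define K where "K x = x powr (s - 1) * (sin (2 * pi * a) / (cosh x - cos (2 * pi * a)))" for x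
  define f where "f n x = 2 * (c n * (x powr (s - 1) / (x\<^sup>2 + (c n)\<^sup>2)) -
      c' n * (x powr (s - 1) / (x\<^sup>2 + (c' n)\<^sup>2)))" for n x
  have c: "0 < c n" "c n \<le> c' n" for n
    using a by (auto simp: c_def c'_def)
  have c': "0 < c' n" for n using c[of n] by linarith
  have a1: "a < 1" using a by simp
  have int: "has_bochner_integral lborel_pos (\<lambda>x. x powr (s - 1) / (x\<^sup>2 + d\<^sup>2)) (\<kappa> * d powr (s - 2))"
    if "d > 0" for d
    unfolding \<kappa>_def using has_bochner_integral_powr_over_sum_squares[of s d] s that by simp
  have f_int: "has_bochner_integral lborel_pos (f n)
      (2 * (c n * (\<kappa> * c n powr (s - 2)) - c' n * (\<kappa> * c' n powr (s - 2))))" for n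
    unfolding f_def
    by (intro has_bochner_integral_mult_right has_bochner_integral_diff int c c')
  have f_val: "2 * (c n * (\<kappa> * c n powr (s - 2)) - c' n * (\<kappa> * c' n powr (s - 2))) =
      2 * \<kappa> * (2 * pi) powr (s - 1) * ((real n + a) powr (s - 1) - (real n + (1 - a)) powr (s - 1))" for n
  proof -
    have "d * d powr (s - 2) = d powr (s - 1)" if "d > 0" for d :: real
      using powr_add[of d 1 "s - 2"] that by simp
    hence eq: "2 * (c n * (\<kappa> * c n powr (s - 2)) - c' n * (\<kappa> * c' n powr (s - 2))) =
        2 * \<kappa> * (c n powr (s - 1) - c' n powr (s - 1))"
      using c c' by (simp add: algebra_simps)
    have cp: "c n powr (s - 1) = (2 * pi) powr (s - 1) * (real n + a) powr (s - 1)"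
      "c' n powr (s - 1) = (2 * pi) powr (s - 1) * (real n + (1 - a)) powr (s - 1)"
      unfolding c_def c'_def using a by (auto intro!: powr_mult)
    show ?thesis unfolding eq cp by (simp add: algebra_simps)
  qed
  have int_f: "integrable lborel_pos (f n)" for n
    using f_int[of n] by (simp add: has_bochner_integral_iff)
  \<comment> \<open>Over the common denominator the numerator is (c' - c)(c c' - x^2). Its second
    factor is at most x^2 + c'^2 and cancels one denominator, while 2(c' - c) = 4 pi (1 - 2a) does
    not depend on n. The bound integrates to a multiple of c^(s-2), summable since s < 1.\<close>
  have norm_f: "norm (f n x) \<le> 4 * pi * (1 - 2 * a) * (x powr (s - 1) / (x\<^sup>2 + (c n)\<^sup>2))"
    if x: "x > 0" for n x
  proof -
    have p: "x\<^sup>2 + (c n)\<^sup>2 > 0" "x\<^sup>2 + (c' n)\<^sup>2 > 0" using x by (auto intro: add_pos_nonneg)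
    have "f n x = 2 * x powr (s - 1) * ((c' n - c n) * (c n * c' n - x\<^sup>2)) /
        ((x\<^sup>2 + (c n)\<^sup>2) * (x\<^sup>2 + (c' n)\<^sup>2))"
      using p by (simp add: f_def divide_simps) (simp add: algebra_simps power2_eq_square)
    also have "norm \<dots> = 2 * x powr (s - 1) * (c' n - c n) * \<bar>c n * c' n - x\<^sup>2\<bar> /
        ((x\<^sup>2 + (c n)\<^sup>2) * (x\<^sup>2 + (c' n)\<^sup>2))"
      using p c[of n] by (simp add: abs_mult mult.assoc)
    also have "\<dots> \<le> 2 * x powr (s - 1) * (c' n - c n) * (x\<^sup>2 + (c' n)\<^sup>2) /
        ((x\<^sup>2 + (c n)\<^sup>2) * (x\<^sup>2 + (c' n)\<^sup>2))"
    proof (intro divide_right_mono mult_left_mono)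
      have "c n * c' n \<le> c' n * c' n" "0 \<le> c n * c' n" using c[of n] c'[of n] by (auto intro!: mult_right_mono)
      thus "\<bar>c n * c' n - x\<^sup>2\<bar> \<le> x\<^sup>2 + (c' n)\<^sup>2"
        using zero_le_power2[of x] unfolding power2_eq_square by linarith
    qed (use p c[of n] in auto)
    also have "\<dots> = 2 * (c' n - c n) * (x powr (s - 1) / (x\<^sup>2 + (c n)\<^sup>2))"
      using p by simp
    also have "2 * (c' n - c n) = 4 * pi * (1 - 2 * a)" by (simp add: c_def c'_def algebra_simps)
    finally show ?thesis .
  qed
  have f_sums: "(\<lambda>n. f n x) sums K x" for x
  proof -
    have "(\<lambda>n. x powr (s - 1) * (2 * (c n / (x\<^sup>2 + (c n)\<^sup>2) - c' n / (x\<^sup>2 + (c' n)\<^sup>2)))) sums K x"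
      unfolding K_def c_def c'_def by (intro sums_mult sin_over_cosh_partial_fractions a a1)
    thus ?thesis by (simp add: f_def algebra_simps)
  qed
  have c_le: "c n powr (s - 2) \<le> real n powr (s - 2)" if "n > 0" for n
  proof (rule powr_mono2')
    have "1 * real n \<le> 2 * pi * (real n + a)"
      using a pi_gt3 by (intro mult_mono) auto
    thus "real n \<le> c n" by (simp add: c_def)
  qed (use s that in auto)
  have c_summable: "summable (\<lambda>n. c n powr (s - 2))"
  proof (rule summable_comparison_test_ev)
    show "\<forall>\<^sub>F n in sequentially. norm (c n powr (s - 2)) \<le> real n powr (s - 2)"
      using eventually_gt_at_top[of 0] by eventually_elim (use c_le in simp)
    show "summable (\<lambda>n. real n powr (s - 2))" using s by (simp add: summable_real_powr_iff)
  qed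
  have AE: "AE x in lborel_pos. summable (\<lambda>n. norm (f n x))"
  proof (rule AE_I2)
    fix x assume "x \<in> space lborel_pos"
    hence x: "x > 0" by simp
    have "summable (\<lambda>n. 4 * pi * (1 - 2 * a) * x powr (s - 1) * real n powr (- 2))"
      by (intro summable_mult) (simp add: summable_real_powr_iff)
    thus "summable (\<lambda>n. norm (f n x))"
    proof (rule summable_comparison_test_ev[rotated])
      show "\<forall>\<^sub>F n in sequentially.
          norm (norm (f n x)) \<le> 4 * pi * (1 - 2 * a) * x powr (s - 1) * real n powr (- 2)"
        using eventually_gt_at_top[of 0]
      proof eventually_elim
        case (elim n)
        have "1 * real n \<le> 2 * pi * (real n + a)"
          using a pi_gt3 by (intro mult_mono) auto
        hence "(real n)\<^sup>2 \<le> x\<^sup>2 + (c n)\<^sup>2"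
          using power_mono[of "real n" "c n" 2] by (simp add: c_def add_increasing)
        hence "x powr (s - 1) / (x\<^sup>2 + (c n)\<^sup>2) \<le> x powr (s - 1) / (real n)\<^sup>2"
          using elim x by (intro divide_left_mono) (auto intro!: mult_pos_pos add_pos_nonneg)
        also have "\<dots> = x powr (s - 1) * real n powr (- 2)"
          using elim by (simp add: powr_minus divide_inverse powr_numeral)
        finally have "4 * pi * (1 - 2 * a) * (x powr (s - 1) / (x\<^sup>2 + (c n)\<^sup>2)) \<le>
            4 * pi * (1 - 2 * a) * (x powr (s - 1) * real n powr (- 2))"
          using a by (intro mult_left_mono) auto
        thus ?case using norm_f[OF x, of n] by simp
      qed
    qed
  qed
  have sm: "summable (\<lambda>n. \<integral>x. norm (f n x) \<partial>lborel_pos)"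
  proof (rule summable_comparison_test)
    show "\<exists>N. \<forall>n\<ge>N. norm (\<integral>x. norm (f n x) \<partial>lborel_pos) \<le>
        4 * pi * (1 - 2 * a) * (\<kappa> * c n powr (s - 2))"
    proof (intro exI allI impI)
      fix n
      have i: "has_bochner_integral lborel_pos (\<lambda>x. 4 * pi * (1 - 2 * a) * (x powr (s - 1) / (x\<^sup>2 + (c n)\<^sup>2)))
          (4 * pi * (1 - 2 * a) * (\<kappa> * c n powr (s - 2)))"
        by (intro has_bochner_integral_mult_right int c)
      have "(\<integral>x. norm (f n x) \<partial>lborel_pos) \<le>
          (\<integral>x. 4 * pi * (1 - 2 * a) * (x powr (s - 1) / (x\<^sup>2 + (c n)\<^sup>2)) \<partial>lborel_pos)"
        using i int_f[of n] norm_f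
        by (intro integral_mono) (auto simp: has_bochner_integral_iff intro!: integrable_norm)
      also have "\<dots> = 4 * pi * (1 - 2 * a) * (\<kappa> * c n powr (s - 2))"
        using i by (simp add: has_bochner_integral_iff)
      finally show "norm (\<integral>x. norm (f n x) \<partial>lborel_pos) \<le> 4 * pi * (1 - 2 * a) * (\<kappa> * c n powr (s - 2))"
        by (simp add: Bochner_Integration.integral_nonneg_AE)
    qed
    show "summable (\<lambda>n. 4 * pi * (1 - 2 * a) * (\<kappa> * c n powr (s - 2)))"
      by (intro summable_mult c_summable)
  qed
  have "(\<lambda>n. integral\<^sup>L lborel_pos (f n)) sums (\<integral>x. (\<Sum>n. f n x) \<partial>lborel_pos)"
    by (rule sums_integral[OF int_f AE sm])
  also have "(\<lambda>x. \<Sum>n. f n x) = K" using f_sums by (simp add: sums_iff fun_eq_iff)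
  also have "(\<lambda>n. integral\<^sup>L lborel_pos (f n)) =
      (\<lambda>n. 2 * \<kappa> * (2 * pi) powr (s - 1) * ((real n + a) powr (s - 1) - (real n + (1 - a)) powr (s - 1)))"
    using f_int unfolding f_val by (simp add: has_bochner_integral_iff)
  finally have "(\<lambda>n. complex_of_real (2 * \<kappa> * (2 * pi) powr (s - 1) *
      ((real n + a) powr (s - 1) - (real n + (1 - a)) powr (s - 1)))) sums of_real (integral\<^sup>L lborel_pos K)"
    by (rule sums_of_real)
  moreover have "(\<lambda>n. complex_of_real (2 * \<kappa> * (2 * pi) powr (s - 1) *
      ((real n + a) powr (s - 1) - (real n + (1 - a)) powr (s - 1)))) sums
      (of_real (2 * \<kappa> * (2 * pi) powr (s - 1)) * Y_zeta a (1 - of_real s))"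
  proof -
    have "(\<lambda>n. of_real (2 * \<kappa> * (2 * pi) powr (s - 1)) *
        (of_real (real n + a) powr (- (1 - of_real s)) - of_real (real n + (1 - a)) powr (- (1 - of_real s))))
        sums (of_real (2 * \<kappa> * (2 * pi) powr (s - 1)) * Y_zeta a (1 - of_real s))"
      by (intro sums_mult Y_zeta_series(2)[OF a(1) a1]) (use s in simp)
    moreover have "complex_of_real m powr (- (1 - of_real s)) = of_real (m powr (s - 1))" if "m \<ge> 0" for m
      using powr_of_real[OF that, of "s - 1"] by simp
    moreover have "real n + a \<ge> 0" "real n + (1 - a) \<ge> 0" for n using a by auto
    ultimately show ?thesis by (simp only: of_real_mult of_real_diff)
  qed
  ultimately have "complex_of_real (integral\<^sup>L lborel_pos K) =
      of_real (2 * \<kappa> * (2 * pi) powr (s - 1)) * Y_zeta a (1 - of_real s)"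
    by (rule sums_unique2)
  moreover have "2 * \<kappa> = pi / sin (pi * s / 2)" by (simp add: \<kappa>_def)
  ultimately show ?thesis
    using O_zeta_Mellin(2)[OF a(1) a1 s(1)] by (simp add: K_def[abs_def])
qed

lemma Y_zeta_pos:
  fixes a s :: real
  assumes a: "0 < a" "a < 1 / 2" and s: "s > 0"
  obtains r where "r > 0" "Y_zeta a (of_real s) = of_real r"
proof -
  define t where "t n = (real n + a) powr (- s) - (real n + (1 - a)) powr (- s)" for n
  have t: "t n > 0" for n
    using a s by (auto simp: t_def intro!: powr_less_mono2_neg)
  have "complex_of_real (t n) =
      of_real (real n + a) powr (- of_real s) - of_real (real n + (1 - a)) powr (- of_real s)" for n
    using a powr_of_real[of "real n + a" "- s"] powr_of_real[of "real n + (1 - a)" "- s"]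
    by (simp add: t_def del: of_real_add)
  hence sums: "(\<lambda>n. complex_of_real (t n)) sums Y_zeta a (of_real s)"
    using Y_zeta_series(2)[of a "of_real s"] a s by (simp del: of_real_add)
  from sums_Re[OF this] have "t sums Re (Y_zeta a (of_real s))" by simp
  hence "Re (Y_zeta a (of_real s)) > 0"
    using suminf_pos[of t] t by (simp add: sums_iff)
  moreover from sums_Im[OF sums] have "Im (Y_zeta a (of_real s)) = 0"
    using sums_unique2[OF sums_zero] by fastforce
  hence "Y_zeta a (of_real s) = of_real (Re (Y_zeta a (of_real s)))"
    by (simp add: complex_eq_iff)
  ultimately show ?thesis using that by blast
qed

text \<open>Riemann's reflection factor with the cosine in place of the sine, as befits functions
  odd under a -> 1 - a. It is used only for Re s < 1, because \<open>Gamma\<close> takes a default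
  value at the poles met when s = 1, 2, ...\<close>

definition chi :: "complex \<Rightarrow> complex" where
  "chi s = 2 * of_real (2 * pi) powr (s - 1) * Gamma (1 - s) * cos (of_real pi * s / 2)"

lemma one_minus_not_nonpos_Int: "Re s < 1 \<Longrightarrow> 1 - s \<notin> \<int>\<^sub>\<le>\<^sub>0" for s :: complex
proof
  assume "Re s < 1" "1 - s \<in> \<int>\<^sub>\<le>\<^sub>0"
  then obtain n where "1 - s = of_int n" "n \<le> 0" by (auto elim!: nonpos_Ints_cases)
  hence "1 - Re s = of_int n" by (metis Re_complex_of_real minus_complex.sel(1) of_real_of_int_eq one_complex.sel(1))
  with \<open>n \<le> 0\<close> \<open>Re s < 1\<close> show False by simp
qed

text \<open>The Mellin computation yields the functional equation only at real points of (0,1).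
  These accumulate at 1/2, inside the half-plane, so the identity theorem applies.\<close>

lemma eq_on_left_half_plane:
  assumes f: "f holomorphic_on {s. Re s < 1}" and g: "g holomorphic_on {s. Re s < 1}"
    and eq: "\<And>x::real. 0 < x \<Longrightarrow> x < 1 \<Longrightarrow> f (of_real x) = g (of_real x)"
    and s: "Re s < 1"
  shows "f s = g s"
proof -
  define U where "U = complex_of_real ` {0<..<1}"
  have lim: "of_real (1 / 2) islimpt U"
    unfolding islimpt_approachable
  proof (intro allI impI)
    fix e :: real assume e: "e > 0"
    define x where "x = 1 / 2 + min (e / 2) (1 / 4)"
    have x: "0 < x" "x < 1" "x \<noteq> 1 / 2" "\<bar>x - 1 / 2\<bar> < e"
      using e by (auto simp: x_def min_def)
    have "dist (complex_of_real x) (of_real (1 / 2)) = \<bar>x - 1 / 2\<bar>"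
      by (simp only: dist_of_real) (simp add: dist_real_def)
    thus "\<exists>y\<in>U. y \<noteq> of_real (1 / 2) \<and> dist y (of_real (1 / 2)) < e"
      using x by (intro bexI[of _ "of_real x"]) (auto simp: U_def simp del: of_real_divide)
  qed
  have "f s - g s = 0"
  proof (rule analytic_continuation[of "\<lambda>s. f s - g s" "{s. Re s < 1}" U "of_real (1 / 2)"])
    show "(\<lambda>s. f s - g s) holomorphic_on {s. Re s < 1}" by (intro holomorphic_intros f g)
    show "connected {s. Re s < 1}" by (intro convex_connected convex_halfspace_Re_lt)
    show "f z - g z = 0" if "z \<in> U" for z using that eq by (auto simp: U_def)
  qed (use s lim in \<open>auto simp: U_def open_halfspace_Re_lt\<close>)
  thus ?thesis by simp
qed

lemma chi_holomorphic: "chi holomorphic_on {s. Re s < 1}"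
  unfolding chi_def[abs_def]
  by (intro holomorphic_intros) (auto dest: one_minus_not_nonpos_Int)

lemma O_zeta_holomorphic:
  assumes "0 < a" "a < 1"
  shows "O_zeta a holomorphic_on UNIV"
  unfolding O_zeta_def[abs_def]
  by (intro holomorphic_intros periodic_zeta_continuation) (use assms in auto)

lemma chi_of_real:
  assumes s: "0 < s" "s < (1 :: real)"
  shows "chi (of_real s) = of_real (2 * (2 * pi) powr (s - 1) * Gamma (1 - s) * cos (pi * s / 2))"
proof -
  have "of_real (2 * pi) powr (of_real s - 1) = complex_of_real ((2 * pi) powr (s - 1))"
    using powr_of_real[of "2 * pi" "s - 1"] by simp
  moreover have "Gamma (1 - of_real s) = complex_of_real (Gamma (1 - s))"
    using Gamma_complex_of_real[of "1 - s"] by simp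
  moreover have "cos (of_real pi * of_real s / 2) = complex_of_real (cos (pi * s / 2))"
    using cos_of_real[of "pi * s / 2", where 'a = complex] by simp
  ultimately show ?thesis by (simp only: chi_def of_real_mult) simp
qed

lemma zeta_functional_equations:
  fixes a :: real
  assumes a: "0 < a" "a < 1 / 2" and s: "Re s < 1"
  shows "Y_zeta a s = chi s * O_zeta a (1 - s)" and "O_zeta a s = chi s * Y_zeta a (1 - s)"
proof -
  have a1: "a < 1" using a by simp
  note hol = Y_zeta_series(1)[OF a(1) a1] O_zeta_holomorphic[OF a(1) a1]
  have hol': "(\<lambda>s. f (1 - s)) holomorphic_on A" if "f holomorphic_on UNIV" for f :: "complex \<Rightarrow> complex" and A
  proof -
    have "(f \<circ> (\<lambda>s. 1 - s)) holomorphic_on A"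
      by (rule holomorphic_on_compose_gen[OF _ that]) (auto intro!: holomorphic_intros)
    thus ?thesis by (simp add: o_def)
  qed
  show "Y_zeta a s = chi s * O_zeta a (1 - s)"
  proof (rule eq_on_left_half_plane[OF _ _ _ s])
    fix x :: real assume x: "0 < x" "x < 1"
    have "0 < sin (pi * (1 - x) / 2)"
      using x by (intro sin_gt_zero) auto
    hence "complex_of_real (pi / sin (pi * (1 - x) / 2) * (2 * pi) powr (- x)) \<noteq> 0"
      by simp
    moreover have "complex_of_real (pi / sin (pi * (1 - x) / 2) * (2 * pi) powr (- x)) * Y_zeta a (of_real x) =
        of_real (Gamma (1 - x)) * O_zeta a (1 - of_real x)"
      using O_zeta_functional_equation_strip[OF a, of "1 - x"] x by simp
    \<comment> \<open>The relation chi(x) chi(1-x) = 1 in disguise: the sine equals cos(pi x/2), and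
      the two powers of 2 pi multiply to 1/(2 pi).\<close>
    moreover have "Gamma (1 - x) = pi / sin (pi * (1 - x) / 2) * (2 * pi) powr (- x) *
        (2 * (2 * pi) powr (x - 1) * Gamma (1 - x) * cos (pi * x / 2))"
    proof -
      have "sin (pi * (1 - x) / 2) = cos (pi * x / 2)"
        using sin_cos_eq[of "pi * (1 - x) / 2"] by (simp add: field_simps)
      moreover have "(2 * pi) powr (- x) * (2 * pi) powr (x - 1) = (2 * pi) powr (- x + (x - 1))"
        by (rule powr_add[symmetric])
      hence "(2 * pi) powr (- x) * (2 * pi) powr (x - 1) = 1 / (2 * pi)"
        by (simp add: powr_neg_one)
      hence "pi * (2 * pi) powr (- x) * (2 * (2 * pi) powr (x - 1)) = 1"
        by (simp add: mult_ac)
      ultimately show ?thesis using \<open>0 < sin (pi * (1 - x) / 2)\<close>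
        by (simp add: field_simps)
    qed
    ultimately show "Y_zeta a (of_real x) = chi (of_real x) * O_zeta a (1 - of_real x)"
      unfolding chi_of_real[OF x] by (metis (no_types, lifting) mult.assoc mult_left_cancel of_real_mult)
  qed (intro holomorphic_intros chi_holomorphic hol' holomorphic_on_subset[OF hol(1)] hol subset_UNIV)+
  show "O_zeta a s = chi s * Y_zeta a (1 - s)"
  proof (rule eq_on_left_half_plane[OF _ _ _ s])
    fix x :: real assume x: "0 < x" "x < 1"
    have sin: "0 < sin (pi * x / 2)" using x by (intro sin_gt_zero) auto
    \<comment> \<open>Reflection together with sin(pi x) = 2 sin(pi x/2) cos(pi x/2) trades the
      quotient by the sine for Gamma(1-x) times the cosine.\<close>
    have "Gamma x * (2 * (2 * pi) powr (x - 1) * Gamma (1 - x) * cos (pi * x / 2)) =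
        pi / sin (pi * x / 2) * (2 * pi) powr (x - 1)"
    proof -
      have "sin (pi * x) = 2 * sin (pi * x / 2) * cos (pi * x / 2)"
        using sin_double[of "pi * x / 2"] by simp
      moreover have "cos (pi * x / 2) > 0" using x by (intro cos_gt_zero) auto
      ultimately have eq: "Gamma x * Gamma (1 - x) * 2 * cos (pi * x / 2) = pi / sin (pi * x / 2)"
        using Gamma_reflection_real[OF x] sin by (simp add: field_simps)
      have "Gamma x * (2 * (2 * pi) powr (x - 1) * Gamma (1 - x) * cos (pi * x / 2)) =
          (Gamma x * Gamma (1 - x) * 2 * cos (pi * x / 2)) * (2 * pi) powr (x - 1)"
        by (simp only: mult_ac)
      thus ?thesis by (simp only: eq)
    qed
    hence "of_real (Gamma x) * O_zeta a (of_real x) =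
        of_real (Gamma x) * (chi (of_real x) * Y_zeta a (1 - of_real x))"
      using O_zeta_functional_equation_strip[OF a x] unfolding chi_of_real[OF x]
      by (metis mult.assoc of_real_mult)
    thus "O_zeta a (of_real x) = chi (of_real x) * Y_zeta a (1 - of_real x)"
      using Gamma_real_pos[OF x(1)] by simp
  qed (intro holomorphic_intros chi_holomorphic hol' holomorphic_on_subset[OF hol(2)] hol subset_UNIV)+
qed

section \<open>Location and multiplicity of the real zeros\<close>

text \<open>Two functions are allowed because reflection swaps \<open>Y_zeta\<close> and
  \<open>O_zeta\<close> but fixes \<open>X_zeta\<close>; the pairs (Y,O), (O,Y) and (X,X) give the
  three cases.\<close>

lemma zeros_of_functional_equation:
  fixes F G :: "complex \<Rightarrow> complex"
  assumes F: "F holomorphic_on UNIV" and G: "G holomorphic_on UNIV"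
    and eq: "\<And>s. Re s < 1 \<Longrightarrow> F s = chi s * G (1 - s)"
    and F_nz: "\<And>x::real. x > 0 \<Longrightarrow> F (of_real x) \<noteq> 0"
    and G_nz: "\<And>x::real. x > 0 \<Longrightarrow> G (of_real x) \<noteq> 0"
  shows "{x::real. F (of_real x) = 0} = real_of_int ` {n. n < 0 \<and> odd n}"
    and "\<And>n::int. n < 0 \<Longrightarrow> odd n \<Longrightarrow> zorder F (of_int n) = 1"
proof -
  \<comment> \<open>Everything but the cosine. For real x \<le> 0 the argument 1 - x is positive, so
    neither \<open>G\<close> nor the Gamma factor vanishes.\<close>
  define h where "h s = 2 * of_real (2 * pi) powr (s - 1) * Gamma (1 - s) * G (1 - s)" for s
  have h_nz: "h (of_real x) \<noteq> 0" if "x \<le> 0" for x :: real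
    using that G_nz[of "1 - x"] one_minus_not_nonpos_Int[of "of_real x"]
    by (simp add: h_def Gamma_eq_zero_iff)
  have F_eq: "F s = h s * cos (of_real pi * s / 2)" if "Re s < 1" for s
    using eq[OF that] by (simp add: h_def chi_def)
  have cos_zero: "cos (of_real pi * of_real x / 2) = (0 :: complex) \<longleftrightarrow> (\<exists>n::int. odd n \<and> x = of_int n)"
    for x :: real
  proof -
    have "cos (of_real pi * of_real x / 2) = complex_of_real (cos (pi * x / 2))"
      using cos_of_real[of "pi * x / 2", where 'a = complex] by simp
    thus ?thesis by (auto simp: cos_zero_iff_int)
  qed
  have zero_iff: "F (of_real x) = 0 \<longleftrightarrow> (\<exists>n::int. n < 0 \<and> odd n \<and> x = of_int n)" for x :: real
  proof (cases "x > 0")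
    case True
    thus ?thesis using F_nz[of x] by auto
  next
    case False
    hence "F (of_real x) = 0 \<longleftrightarrow> (\<exists>n::int. odd n \<and> x = of_int n)"
      using F_eq[of "of_real x"] h_nz[of x] cos_zero[of x] by simp
    moreover have "n < 0" if "odd n" "x = of_int n" for n :: int
    proof -
      have "n \<le> 0" using False that by simp
      moreover have "n \<noteq> 0" using that by auto
      ultimately show ?thesis by simp
    qed
    ultimately show ?thesis by blast
  qed
  thus "{x::real. F (of_real x) = 0} = real_of_int ` {n. n < 0 \<and> odd n}" by auto
  fix n :: int assume n: "n < 0" "odd n"
  define z where "z = complex_of_int n"
  have z: "Re z < 1" "z = of_real (of_int n)" using n by (auto simp: z_def)
  have op: "open {s. Re s < 1}" by (rule open_halfspace_Re_lt)
  have cos0: "cos (of_real pi * z / 2) = 0"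
    unfolding z(2) using cos_zero[of "of_int n"] n by blast
  hence sin_nz: "sin (of_real pi * z / 2) \<noteq> 0"
    using sin_cos_squared_add[of "of_real pi * z / 2"] by auto
  have "h holomorphic_on {s. Re s < 1}"
  proof -
    have "(G \<circ> (\<lambda>s. 1 - s)) holomorphic_on {s. Re s < 1}"
      by (rule holomorphic_on_compose_gen[OF _ G]) (auto intro!: holomorphic_intros)
    thus ?thesis unfolding h_def[abs_def] o_def
      by (intro holomorphic_intros) (auto dest: one_minus_not_nonpos_Int)
  qed
  then obtain h' where h': "(h has_field_derivative h') (at z)"
    using holomorphic_derivI[OF _ op] z by blast
  \<comment> \<open>At a zero of the cosine the term with \<open>h'\<close> drops out, and the other
    is nonzero because sine and cosine have no common zero; so the zero of \<open>F\<close> is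
    simple.\<close>
  have "((\<lambda>s. h s * cos (of_real pi * s / 2)) has_field_derivative
      h z * (- sin (of_real pi * z / 2) * (of_real pi / 2)) + h' * cos (of_real pi * z / 2)) (at z)"
    by (rule DERIV_mult'[OF h']) (auto intro!: derivative_eq_intros)
  hence "(F has_field_derivative
      h z * (- sin (of_real pi * z / 2) * (of_real pi / 2)) + h' * cos (of_real pi * z / 2)) (at z)"
    by (rule has_field_derivative_transform_within_open[OF _ op]) (use z F_eq in auto)
  hence "deriv F z = h z * (- sin (of_real pi * z / 2) * (of_real pi / 2))"
    using cos0 by (simp add: DERIV_imp_deriv)
  moreover have "h z \<noteq> 0" unfolding z(2) using n by (intro h_nz) auto
  ultimately have "deriv F z \<noteq> 0" using sin_nz by simp
  moreover have "F z = 0" using F_eq[OF z(1)] cos0 by simp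
  ultimately show "zorder F (of_int n) = 1"
    unfolding z_def[symmetric] by (intro zorder_zero_eqI[OF F open_UNIV]) auto
qed

theorem theorem1p2:
  fixes a :: real
  assumes "0 < a" and "a < 1 / 2"
  shows "\<forall>F \<in> {Y_zeta a, O_zeta a, X_zeta a}.
           {x::real. F (of_real x) = 0} = real_of_int ` {n. n < 0 \<and> odd n} \<and>
           (\<forall>n::int. n < 0 \<and> odd n \<longrightarrow> zorder F (of_int n) = 1)"
proof -
  have a1: "a < 1" using assms by simp
  note hY = Y_zeta_series(1)[OF assms(1) a1] and hO = O_zeta_holomorphic[OF assms(1) a1]
  have hX: "X_zeta a holomorphic_on UNIV"
    unfolding X_zeta_def[abs_def] by (intro holomorphic_intros hY hO)
  note fe = zeta_functional_equations[OF assms]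
  have feX: "X_zeta a s = chi s * X_zeta a (1 - s)" if "Re s < 1" for s
    using fe[OF that] by (simp add: X_zeta_def algebra_simps)
  have Y: "Y_zeta a (of_real x) \<noteq> 0" and O: "O_zeta a (of_real x) \<noteq> 0"
    and X: "X_zeta a (of_real x) \<noteq> 0" if x: "x > 0" for x :: real
  proof -
    obtain r where r: "r > 0" "Y_zeta a (of_real x) = of_real r"
      using Y_zeta_pos[OF assms x] .
    obtain q where q: "q > 0" "O_zeta a (of_real x) = of_real q"
      using O_zeta_pos[OF assms x] .
    have "X_zeta a (of_real x) = of_real (r + q)" using r q by (simp add: X_zeta_def)
    thus "X_zeta a (of_real x) \<noteq> 0" using r q by (simp del: of_real_add)
    show "Y_zeta a (of_real x) \<noteq> 0" "O_zeta a (of_real x) \<noteq> 0" using r q by auto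
  qed
  note zY = zeros_of_functional_equation[OF hY hO fe(1) Y O]
    and zO = zeros_of_functional_equation[OF hO hY fe(2) O Y]
    and zX = zeros_of_functional_equation[OF hX hX feX X X]
  show ?thesis using zY zO zX by blast
qed

end
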